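(* If $(M,\mathcal D,\mathcal P)$ is a first-order polarised $k$-contact manifold, then $\mathcal P$ is a polarisation of $(M,\mathcal D)$, i.e. $\mathcal P$ is an integrable Legendrian subbundle of $\mathcal D$ that has maximal rank among all the integrable Legendrian subbundles of $\mathcal D$.
   Context: A $k$-contact form on an open set $U$ is an $\mathbb R^k$-valued one-form $\boldsymbol\eta=\sum_A\eta^A\otimes e_A$ with $\ker\boldsymbol\eta=\bigcap_A\ker\eta^A$ a non-zero distribution of corank $k$ and $\ker\boldsymbol\eta\oplus\ker d\boldsymbol\eta=TU$, $\ker d\boldsymbol\eta=\bigcap_A\ker d\eta^A$. A $k$-contact manifold $(M,\mathcal D)$ is a manifold with a regular corank-$k$ distribution that is locally, around every point, the kernel of a $k$-contact form. A first-order polarised $k$-contact manifold is a triple $(M,\mathcal D,\mathcal P)$ with $(M,\mathcal D)$ a $k$-contact manifold, $\dim M=nk+n+k$ for some positive integers $n,k$, and $\mathcal P\subset\mathcal D$ an integrable subbundle of rank $nk$. The Levi tensor is $\mathcal L_{\mathcal D}:\Lambda^2\mathcal D\to TM/\mathcal D$, $\mathcal L_{\mathcal D}(X_x,Y_x)=[X,Y]_x\bmod\mathcal D_x$. A subspace $E_x\subset\mathcal D_x$ is isotropic if $\mathcal L_{\mathcal D}$ vanishes on $E_x\times E_x$ and Legendrian if it is isotropic and admits an isotropic complement in $\mathcal D_x$; a subbundle is Legendrian if it is so at every point. *)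

theory Defs
  imports "HOL-Analysis.Analysis"
begin

section \<open>Smooth maps between Euclidean spaces\<close>

text \<open>Meant for open \<open>S\<close>, where \<open>at x\<close> and \<open>at x within S\<close> agree for \<open>x \<in> S\<close>.\<close>

fun Ck_on :: "nat \<Rightarrow> ('a::euclidean_space \<Rightarrow> 'b::real_normed_vector) \<Rightarrow> 'a set \<Rightarrow> bool" where
  "Ck_on 0 f S \<longleftrightarrow> continuous_on S f"
| "Ck_on (Suc r) f S \<longleftrightarrow> (\<forall>x\<in>S. f differentiable (at x)) \<and>
     (\<forall>v. Ck_on r (\<lambda>x. frechet_derivative f (at x) v) S)"

definition smooth_on :: "('a::euclidean_space \<Rightarrow> 'b::real_normed_vector) \<Rightarrow> 'a set \<Rightarrow> bool" where
  "smooth_on f S \<longleftrightarrow> (\<forall>r. Ck_on r f S)"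

section \<open>Smooth manifolds\<close>

text \<open>A chart is a pair of a domain and a coordinate map; only the values of the map on the
  domain are relevant. The manifold has the point set \<^term>\<open>topspace M\<close> and is
  modelled on \<open>'e\<close>, so its dimension is \<open>DIM('e)\<close>.\<close>

type_synonym ('m, 'e) chart = "'m set \<times> ('m \<Rightarrow> 'e)"

abbreviation cdom :: "('m, 'e) chart \<Rightarrow> 'm set" where "cdom \<equiv> fst"

abbreviation coord :: "('m, 'e) chart \<Rightarrow> 'm \<Rightarrow> 'e" where "coord \<equiv> snd"

definition coord_inv :: "('m, 'e) chart \<Rightarrow> 'e \<Rightarrow> 'm" where
  "coord_inv c = inv_into (cdom c) (coord c)"

definition is_chart :: "'m topology \<Rightarrow> ('m, 'e::euclidean_space) chart \<Rightarrow> bool" where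
  "is_chart M c \<longleftrightarrow> openin M (cdom c) \<and> open (coord c ` cdom c) \<and>
     homeomorphic_map (subtopology M (cdom c)) (top_of_set (coord c ` cdom c)) (coord c)"

definition transition :: "('m, 'e) chart \<Rightarrow> ('m, 'e) chart \<Rightarrow> 'e \<Rightarrow> 'e" where
  "transition c c' = coord c' \<circ> coord_inv c"

definition compatible ::
    "('m, 'e::euclidean_space) chart \<Rightarrow> ('m, 'e) chart \<Rightarrow> bool" where
  "compatible c c' \<longleftrightarrow>
     smooth_on (transition c c') (coord c ` (cdom c \<inter> cdom c')) \<and>
     smooth_on (transition c' c) (coord c' ` (cdom c \<inter> cdom c'))"

text \<open>The third conjunct says both that the charts in \<open>A\<close> are pairwise compatible and that \<open>A\<close> is
  maximal with this property.\<close>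

definition smooth_manifold :: "'m topology \<Rightarrow> ('m, 'e::euclidean_space) chart set \<Rightarrow> bool" where
  "smooth_manifold M A \<longleftrightarrow> Hausdorff_space M \<and> second_countable M \<and>
     A = {c. is_chart M c \<and> (\<forall>c'\<in>A. compatible c c')} \<and>
     \<Union> (cdom ` A) = topspace M"

section \<open>Tangent vectors, vector fields, one-forms\<close>

text \<open>The tangent space at \<open>x\<close> is identified with \<open>'e\<close> by means of one chosen
  chart \<open>chart_at A x\<close> around \<open>x\<close>. As the chosen chart changes with \<open>x\<close>, smoothness of
  tangent objects can only be read off after passing to the coordinates of one fixed chart
  \<open>c\<close>, which is what \<open>chart_deriv A c x\<close>, the differential at \<open>x\<close> of the
  coordinate map of \<open>c\<close>, and its inverse are for. The differential at \<open>x\<close> of the chosen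
  chart itself is the identity.\<close>

definition chart_at :: "('m, 'e) chart set \<Rightarrow> 'm \<Rightarrow> ('m, 'e) chart" where
  "chart_at A x = (SOME c. c \<in> A \<and> x \<in> cdom c)"

definition chart_deriv ::
    "('m, 'e::euclidean_space) chart set \<Rightarrow> ('m, 'e) chart \<Rightarrow> 'm \<Rightarrow> 'e \<Rightarrow> 'e" where
  "chart_deriv A c x =
     frechet_derivative (transition (chart_at A x) c) (at (coord (chart_at A x) x))"

definition chart_deriv_inv ::
    "('m, 'e::euclidean_space) chart set \<Rightarrow> ('m, 'e) chart \<Rightarrow> 'm \<Rightarrow> 'e \<Rightarrow> 'e" where
  "chart_deriv_inv A c x =
     frechet_derivative (transition c (chart_at A x)) (at (coord c x))"

definition vf_rep ::
    "('m, 'e::euclidean_space) chart set \<Rightarrow> ('m, 'e) chart \<Rightarrow> ('m \<Rightarrow> 'e) \<Rightarrow> 'e \<Rightarrow> 'e" where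
  "vf_rep A c X y = chart_deriv A c (coord_inv c y) (X (coord_inv c y))"

definition smooth_vf ::
    "('m, 'e::euclidean_space) chart set \<Rightarrow> 'm set \<Rightarrow> ('m \<Rightarrow> 'e) \<Rightarrow> bool" where
  "smooth_vf A U X \<longleftrightarrow> (\<forall>c\<in>A. smooth_on (vf_rep A c X) (coord c ` (U \<inter> cdom c)))"

definition form_rep ::
    "('m, 'e::euclidean_space) chart set \<Rightarrow> ('m, 'e) chart \<Rightarrow> ('m \<Rightarrow> 'e \<Rightarrow> real) \<Rightarrow> 'e \<Rightarrow> 'e \<Rightarrow> real"
  where
  "form_rep A c \<alpha> y w = \<alpha> (coord_inv c y) (chart_deriv_inv A c (coord_inv c y) w)"

definition smooth_one_form ::
    "('m, 'e::euclidean_space) chart set \<Rightarrow> 'm set \<Rightarrow> ('m \<Rightarrow> 'e \<Rightarrow> real) \<Rightarrow> bool" where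
  "smooth_one_form A U \<alpha> \<longleftrightarrow> (\<forall>x\<in>U. linear (\<alpha> x)) \<and>
     (\<forall>c\<in>A. \<forall>w. smooth_on (\<lambda>y. form_rep A c \<alpha> y w) (coord c ` (U \<inter> cdom c)))"

text \<open>The coordinate expressions of \<open>[X, Y]\<close> and \<open>d\<alpha>\<close> at \<open>x\<close> are evaluated in the chosen
  chart at \<open>x\<close>, so no conversion of tangent vectors at \<open>x\<close> is needed.\<close>

definition lie_bracket ::
    "('m, 'e::euclidean_space) chart set \<Rightarrow> ('m \<Rightarrow> 'e) \<Rightarrow> ('m \<Rightarrow> 'e) \<Rightarrow> 'm \<Rightarrow> 'e" where
  "lie_bracket A X Y x = (let c = chart_at A x in
     frechet_derivative (vf_rep A c Y) (at (coord c x)) (X x) -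
     frechet_derivative (vf_rep A c X) (at (coord c x)) (Y x))"

definition ext_deriv ::
    "('m, 'e::euclidean_space) chart set \<Rightarrow> ('m \<Rightarrow> 'e \<Rightarrow> real) \<Rightarrow> 'm \<Rightarrow> 'e \<Rightarrow> 'e \<Rightarrow> real" where
  "ext_deriv A \<alpha> x u v = (let c = chart_at A x in
     frechet_derivative (\<lambda>y. form_rep A c \<alpha> y v) (at (coord c x)) u -
     frechet_derivative (\<lambda>y. form_rep A c \<alpha> y u) (at (coord c x)) v)"

section \<open>Distributions\<close>

definition direct_sum :: "'e::euclidean_space set \<Rightarrow> 'e set \<Rightarrow> 'e set \<Rightarrow> bool" where
  "direct_sum V S T \<longleftrightarrow> subspace S \<and> subspace T \<and> S \<inter> T = {0} \<and> {a + b | a b. a \<in> S \<and> b \<in> T} = V"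

text \<open>A family \<open>E\<close> of subspaces \<open>E x\<close> of the tangent spaces is a subbundle of rank
  \<open>r\<close> (a regular distribution) if it has smooth local frames of length \<open>r\<close>.\<close>

definition subbundle ::
    "'m topology \<Rightarrow> ('m, 'e::euclidean_space) chart set \<Rightarrow> nat \<Rightarrow> ('m \<Rightarrow> 'e set) \<Rightarrow> bool" where
  "subbundle M A r E \<longleftrightarrow> (\<forall>x\<in>topspace M. \<exists>U b. openin M U \<and> x \<in> U \<and>
     (\<forall>i<r. smooth_vf A U (b i)) \<and>
     (\<forall>y\<in>U. E y = span ((\<lambda>i. b i y) ` {..<r}) \<and> dim (E y) = r))"

definition local_section ::
    "'m topology \<Rightarrow> ('m, 'e::euclidean_space) chart set \<Rightarrow> ('m \<Rightarrow> 'e set) \<Rightarrow> 'm \<Rightarrow> ('m \<Rightarrow> 'e) \<Rightarrow> bool"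
  where
  "local_section M A E x X \<longleftrightarrow>
     (\<exists>U. openin M U \<and> x \<in> U \<and> smooth_vf A U X \<and> (\<forall>y\<in>U. X y \<in> E y))"

text \<open>\<open>N\<close> is an (embedded) integral manifold of \<open>E\<close>: around each of its points it is, in
  suitable coordinates, a piece of an affine subspace with direction \<open>W\<close>, and its tangent
  spaces, which in these coordinates are all \<open>W\<close>, are the fibres of \<open>E\<close>.\<close>

definition integral_manifold ::
    "'m topology \<Rightarrow> ('m, 'e::euclidean_space) chart set \<Rightarrow> ('m \<Rightarrow> 'e set) \<Rightarrow> 'm set \<Rightarrow> bool" where
  "integral_manifold M A E N \<longleftrightarrow> N \<subseteq> topspace M \<and>
     (\<forall>y\<in>N. \<exists>c\<in>A. \<exists>W. y \<in> cdom c \<and> subspace W \<and>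
        coord c ` (N \<inter> cdom c) = {z \<in> coord c ` cdom c. z - coord c y \<in> W} \<and>
        (\<forall>y'\<in>N \<inter> cdom c. E y' = {v. chart_deriv A c y' v \<in> W}))"

text \<open>Immersed submanifolds being locally embedded, it does not matter whether integral
  manifolds are taken to be embedded or merely immersed here.\<close>

definition integrable_distribution ::
    "'m topology \<Rightarrow> ('m, 'e::euclidean_space) chart set \<Rightarrow> ('m \<Rightarrow> 'e set) \<Rightarrow> bool" where
  "integrable_distribution M A E \<longleftrightarrow>
     (\<forall>x\<in>topspace M. \<exists>N. x \<in> N \<and> integral_manifold M A E N)"

section \<open>k-contact manifolds\<close>

text \<open>The components of an \<open>\<real>\<^sup>k\<close>-valued one-form are \<open>\<eta> a\<close> for \<open>a < k\<close>.\<close>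

definition ker_form :: "nat \<Rightarrow> (nat \<Rightarrow> 'm \<Rightarrow> 'e \<Rightarrow> real) \<Rightarrow> 'm \<Rightarrow> 'e set" where
  "ker_form k \<eta> x = {v. \<forall>a<k. \<eta> a x v = 0}"

definition ker_ext_deriv ::
    "('m, 'e::euclidean_space) chart set \<Rightarrow> nat \<Rightarrow> (nat \<Rightarrow> 'm \<Rightarrow> 'e \<Rightarrow> real) \<Rightarrow> 'm \<Rightarrow> 'e set" where
  "ker_ext_deriv A k \<eta> x = {v. \<forall>a<k. \<forall>w. ext_deriv A (\<eta> a) x v w = 0}"

definition k_contact_form ::
    "'m topology \<Rightarrow> ('m, 'e::euclidean_space) chart set \<Rightarrow> nat \<Rightarrow> 'm set \<Rightarrow>
     (nat \<Rightarrow> 'm \<Rightarrow> 'e \<Rightarrow> real) \<Rightarrow> bool" where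
  "k_contact_form M A k U \<eta> \<longleftrightarrow> openin M U \<and> (\<forall>a<k. smooth_one_form A U (\<eta> a)) \<and>
     (\<forall>x\<in>U. ker_form k \<eta> x \<noteq> {0} \<and> dim (ker_form k \<eta> x) + k = DIM('e) \<and>
        direct_sum UNIV (ker_form k \<eta> x) (ker_ext_deriv A k \<eta> x))"

definition k_contact_manifold ::
    "'m topology \<Rightarrow> ('m, 'e::euclidean_space) chart set \<Rightarrow> nat \<Rightarrow> ('m \<Rightarrow> 'e set) \<Rightarrow> bool" where
  "k_contact_manifold M A k D \<longleftrightarrow> smooth_manifold M A \<and>
     (\<exists>r. r + k = DIM('e) \<and> subbundle M A r D) \<and>
     (\<forall>x\<in>topspace M. \<exists>U \<eta>. x \<in> U \<and> k_contact_form M A k U \<eta> \<and>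
        (\<forall>y\<in>U. D y = ker_form k \<eta> y))"

text \<open>Here \<open>n\<close> and \<open>k\<close> are the parameters of the dimension formula.\<close>

definition first_order_polarised ::
    "'m topology \<Rightarrow> ('m, 'e::euclidean_space) chart set \<Rightarrow> nat \<Rightarrow> nat \<Rightarrow>
     ('m \<Rightarrow> 'e set) \<Rightarrow> ('m \<Rightarrow> 'e set) \<Rightarrow> bool" where
  "first_order_polarised M A n k D P \<longleftrightarrow> k_contact_manifold M A k D \<and>
     n > 0 \<and> k > 0 \<and> DIM('e) = n * k + n + k \<and>
     subbundle M A (n * k) P \<and> (\<forall>x\<in>topspace M. P x \<subseteq> D x) \<and>
     integrable_distribution M A P"

section \<open>The Levi tensor, Legendrian subbundles and polarisations\<close>

text \<open>Elements of the quotient of the tangent space at \<open>x\<close> by \<open>D x\<close> are cosets, with zero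
  \<open>D x\<close>. The coset \<open>[X, Y] x + D x\<close> depends only on \<open>X x\<close> and \<open>Y x\<close> when \<open>D\<close> is a regular
  distribution, so that the union below over all extensions of \<open>u\<close> and \<open>v\<close> to
  local sections is a single coset.\<close>

definition levi ::
    "'m topology \<Rightarrow> ('m, 'e::euclidean_space) chart set \<Rightarrow> ('m \<Rightarrow> 'e set) \<Rightarrow> 'm \<Rightarrow> 'e \<Rightarrow> 'e \<Rightarrow> 'e set"
  where
  "levi M A D x u v = {lie_bracket A X Y x + w | X Y w.
     local_section M A D x X \<and> local_section M A D x Y \<and> X x = u \<and> Y x = v \<and> w \<in> D x}"

definition isotropic ::
    "'m topology \<Rightarrow> ('m, 'e::euclidean_space) chart set \<Rightarrow> ('m \<Rightarrow> 'e set) \<Rightarrow> 'm \<Rightarrow> 'e set \<Rightarrow> bool"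
  where
  "isotropic M A D x E \<longleftrightarrow> subspace E \<and> E \<subseteq> D x \<and> (\<forall>u\<in>E. \<forall>v\<in>E. levi M A D x u v = D x)"

definition legendrian ::
    "'m topology \<Rightarrow> ('m, 'e::euclidean_space) chart set \<Rightarrow> ('m \<Rightarrow> 'e set) \<Rightarrow> 'm \<Rightarrow> 'e set \<Rightarrow> bool"
  where
  "legendrian M A D x E \<longleftrightarrow> isotropic M A D x E \<and>
     (\<exists>F. isotropic M A D x F \<and> direct_sum (D x) E F)"

definition integrable_legendrian_subbundle ::
    "'m topology \<Rightarrow> ('m, 'e::euclidean_space) chart set \<Rightarrow> ('m \<Rightarrow> 'e set) \<Rightarrow> ('m \<Rightarrow> 'e set) \<Rightarrow> bool"
  where
  "integrable_legendrian_subbundle M A D E \<longleftrightarrow> (\<exists>r. subbundle M A r E) \<and>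
     (\<forall>x\<in>topspace M. E x \<subseteq> D x) \<and> integrable_distribution M A E \<and>
     (\<forall>x\<in>topspace M. legendrian M A D x (E x))"

text \<open>Ranks of subbundles are compared as dimensions of fibres.\<close>

definition polarisation ::
    "'m topology \<Rightarrow> ('m, 'e::euclidean_space) chart set \<Rightarrow> ('m \<Rightarrow> 'e set) \<Rightarrow> ('m \<Rightarrow> 'e set) \<Rightarrow> bool"
  where
  "polarisation M A D P \<longleftrightarrow> integrable_legendrian_subbundle M A D P \<and>
     (\<forall>Q. integrable_legendrian_subbundle M A D Q \<longrightarrow>
        (\<forall>x\<in>topspace M. dim (Q x) \<le> dim (P x)))"

end

theory Submission
  imports Defs
begin

text \<open>Let \<open>\<eta>\<close> be a local \<open>k\<close>-contact form with kernel \<open>D\<close>. For sections \<open>X\<close>, \<open>Y\<close> of \<open>D\<close> one has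
  \<open>\<eta> [X, Y] = - d\<eta> (X, Y)\<close>, so a subspace of \<open>D x\<close> is isotropic for the Levi tensor exactly when the
  \<open>k\<close> alternating forms \<open>d\<eta> a\<close> vanish on it (\<open>isotropic_iff\<close>). On \<open>D x\<close> these forms have no common
  kernel, because the kernels of \<open>\<eta>\<close> and \<open>d\<eta>\<close> are complementary. After this translation the
  theorem splits into one statement of calculus and two of linear algebra.

  The calculus statement is that the fibres of an integrable \<open>P\<close> inside \<open>D\<close> are isotropic
  (\<open>ext_deriv_vanishes_on_integrable\<close>). In a chart in which an integral manifold is flat, the
  components of \<open>\<eta>\<close> along the manifold vanish on it, and so do their derivatives along it. As the tangent vectors at \<open>x\<close> are expressed in a chart that need
  not be the flattening one, this requires the invariance of \<open>d\<eta>\<close> under transition maps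
  (\<open>ext_deriv_in_chart\<close>), which rests on the symmetry of second derivatives.

  For the linear algebra, let \<open>E\<close> be an isotropic subspace of \<open>D x\<close> and \<open>F\<close> any complement of it in
  \<open>D x\<close>. The forms send \<open>E\<close> to the \<open>k\<close>-fold power of the dual of \<open>F\<close>, injectively, as a vector in
  the kernel of this map would be in the common kernel of the forms. So \<open>dim E \<le> k * dim F\<close>
  (\<open>totally_isotropic_dim_le\<close>), which together with \<open>dim E + dim F = n * (k + 1)\<close> gives
  \<open>dim E \<le> n * k\<close>: no isotropic subspace has larger dimension than \<open>P x\<close>. For \<open>E = P x\<close> the dimensions agree, the map is bijective, and
  this freedom suffices to shear \<open>F\<close> along \<open>E\<close> into an isotropic complement
  (\<open>totally_isotropic_complement\<close>), so \<open>P x\<close> is Legendrian.\<close>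

section \<open>Calculus in Euclidean space\<close>

lemma smooth_on_differentiable:
  assumes "smooth_on f S" "x \<in> S"
  shows "f differentiable (at x)"
  using assms Ck_on.simps(2) unfolding smooth_on_def by blast

lemma smooth_on_frechet_derivative:
  assumes "smooth_on f S"
  shows "smooth_on (\<lambda>x. frechet_derivative f (at x) v) S"
  using assms Ck_on.simps(2) unfolding smooth_on_def by blast

lemma smooth_on_continuous:
  assumes "smooth_on f S"
  shows "continuous_on S f"
  using assms Ck_on.simps(1) unfolding smooth_on_def by blast

lemma smooth_on_subset:
  assumes "smooth_on f S" "T \<subseteq> S"
  shows "smooth_on f T"
proof -
  have "Ck_on r f T" if "Ck_on r f S" for r
    using that
  proof (induction r arbitrary: f)
    case 0
    then show ?case using assms(2) continuous_on_subset by auto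
  next
    case (Suc r)
    then show ?case using assms(2) by auto
  qed
  with assms(1) show ?thesis unfolding smooth_on_def by blast
qed

lemma Ck_on_cong:
  assumes "Ck_on r f S" "open S" "\<And>x. x \<in> S \<Longrightarrow> f x = g x"
  shows "Ck_on r g S"
  using assms(1,3)
proof (induction r arbitrary: f g)
  case 0
  then show ?case using continuous_on_cong by fastforce
next
  case (Suc r)
  have fd: "f differentiable (at x)" if "x \<in> S" for x
    using Suc.prems(1) that by simp
  have eq: "frechet_derivative f (at x) = frechet_derivative g (at x)" if "x \<in> S" for x
    by (rule frechet_derivative_transform_within_open[OF fd[OF that] assms(2) that Suc.prems(2)])
  have gd: "g differentiable (at x)" if "x \<in> S" for x
    using fd[OF that] Suc.prems(2) assms(2) that
    unfolding differentiable_def by (metis has_derivative_transform_within_open)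
  have "Ck_on r (\<lambda>x. frechet_derivative g (at x) v) S" for v
    by (rule Suc.IH[of "\<lambda>x. frechet_derivative f (at x) v"]) (use Suc.prems(1) eq in auto)
  with gd show ?case by simp
qed

lemma smooth_on_cong:
  assumes "smooth_on f S" "open S" "\<And>x. x \<in> S \<Longrightarrow> f x = g x"
  shows "smooth_on g S"
  using assms Ck_on_cong unfolding smooth_on_def by blast

lemma frechet_derivative_scaleR_add:
  assumes "f differentiable (at x)" "g differentiable (at x)"
  shows "((\<lambda>y. f y + c *\<^sub>R g y) has_derivative
      (\<lambda>v. frechet_derivative f (at x) v + c *\<^sub>R frechet_derivative g (at x) v)) (at x)"
  using assms unfolding frechet_derivative_works by (intro derivative_intros)

lemma Ck_on_add_scaleR:
  assumes "Ck_on r f S" "Ck_on r g S" "open S"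
  shows "Ck_on r (\<lambda>x. f x + c *\<^sub>R g x) S"
  using assms(1,2)
proof (induction r arbitrary: f g)
  case 0
  then show ?case by (auto intro!: continuous_intros)
next
  case (Suc r)
  have hd: "((\<lambda>y. f y + c *\<^sub>R g y) has_derivative
      (\<lambda>v. frechet_derivative f (at x) v + c *\<^sub>R frechet_derivative g (at x) v)) (at x)"
    if "x \<in> S" for x
    using Suc.prems that by (intro frechet_derivative_scaleR_add) auto
  have "Ck_on r (\<lambda>x. frechet_derivative f (at x) v + c *\<^sub>R frechet_derivative g (at x) v) S" for v
    using Suc.prems by (intro Suc.IH) auto
  then have "Ck_on r (\<lambda>x. frechet_derivative (\<lambda>y. f y + c *\<^sub>R g y) (at x) v) S" for v
    by (rule Ck_on_cong[OF _ assms(3)]) (simp add: frechet_derivative_at[OF hd, symmetric])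
  with hd show ?case unfolding Ck_on.simps differentiable_def by blast
qed

lemma smooth_on_zero: "smooth_on (\<lambda>x. 0) S"
proof -
  have "Ck_on r (\<lambda>x. 0) S" for r by (induction r) auto
  then show ?thesis unfolding smooth_on_def by blast
qed

lemma smooth_on_sum_scaleR:
  assumes "finite I" "\<And>i. i \<in> I \<Longrightarrow> smooth_on (f i) S" "open S"
  shows "smooth_on (\<lambda>x. \<Sum>i\<in>I. c i *\<^sub>R f i x) S"
  using assms(1,2)
proof (induction I rule: finite_induct)
  case empty
  then show ?case by (simp add: smooth_on_zero)
next
  case (insert j I)
  have "smooth_on (\<lambda>x. (\<Sum>i\<in>I. c i *\<^sub>R f i x) + c j *\<^sub>R f j x) S"
    using insert Ck_on_add_scaleR[OF _ _ assms(3)] unfolding smooth_on_def by blast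
  then show ?case using insert.hyps by (simp add: add.commute)
qed

text \<open>Two applications of the mean value theorem, first along \<open>u\<close> to the increment in direction
  \<open>v\<close>, then along \<open>v\<close> to the derivative in direction \<open>u\<close>. The left-hand side is symmetric in
  \<open>u\<close> and \<open>v\<close>, which is the source of the symmetry of second derivatives.\<close>

lemma second_difference_mean_value:
  fixes f :: "'a::real_normed_vector \<Rightarrow> real"
  assumes s: "s > 0"
    and S: "\<And>a b. a \<in> {0..s} \<Longrightarrow> b \<in> {0..s} \<Longrightarrow> x + a *\<^sub>R u + b *\<^sub>R v \<in> S"
    and f: "\<And>y. y \<in> S \<Longrightarrow> (f has_derivative f' y) (at y)"
    and f': "\<And>y. y \<in> S \<Longrightarrow> ((\<lambda>y. f' y u) has_derivative f'' y) (at y)"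
  obtains a b where "a \<in> {0..s}" "b \<in> {0..s}"
    "f (x + s *\<^sub>R u + s *\<^sub>R v) - f (x + s *\<^sub>R u) - f (x + s *\<^sub>R v) + f x
       = s * (s * f'' (x + a *\<^sub>R u + b *\<^sub>R v) v)"
proof -
  define g where "g t = f (x + t *\<^sub>R u + s *\<^sub>R v) - f (x + t *\<^sub>R u)" for t
  have g: "(g has_derivative (\<lambda>h. h * (f' (x + t *\<^sub>R u + s *\<^sub>R v) u - f' (x + t *\<^sub>R u) u))) (at t)"
    if t: "0 \<le> t" "t \<le> s" for t
  proof -
    have 1: "x + t *\<^sub>R u + s *\<^sub>R v \<in> S" "x + t *\<^sub>R u \<in> S"
      using S[of t s] S[of t 0] t s by auto
    have 2: "linear (f' (x + t *\<^sub>R u + s *\<^sub>R v))" "linear (f' (x + t *\<^sub>R u))"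
      using f 1 has_derivative_linear by blast+
    have "((\<lambda>t. f (x + t *\<^sub>R u + s *\<^sub>R v)) has_derivative
        (\<lambda>h. f' (x + t *\<^sub>R u + s *\<^sub>R v) (h *\<^sub>R u))) (at t)"
      by (rule has_derivative_compose[where f = "\<lambda>t. x + t *\<^sub>R u + s *\<^sub>R v" and g = f, OF _ f[OF 1(1)]])
        (auto intro!: derivative_eq_intros)
    moreover have "((\<lambda>t. f (x + t *\<^sub>R u)) has_derivative (\<lambda>h. f' (x + t *\<^sub>R u) (h *\<^sub>R u))) (at t)"
      by (rule has_derivative_compose[where f = "\<lambda>t. x + t *\<^sub>R u" and g = f, OF _ f[OF 1(2)]])
        (auto intro!: derivative_eq_intros)
    ultimately show ?thesis unfolding g_def
      by (rule has_derivative_diff[THEN has_derivative_eq_rhs])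
        (simp add: linear_cmul[OF 2(1)] linear_cmul[OF 2(2)] fun_eq_iff right_diff_distrib)
  qed
  obtain a where a: "0 < a" "a < s"
      "g s - g 0 = s * (f' (x + a *\<^sub>R u + s *\<^sub>R v) u - f' (x + a *\<^sub>R u) u)"
    using mvt_simple[OF s has_derivative_at_withinI[OF g]] by auto
  define h where "h t = f' (x + a *\<^sub>R u + t *\<^sub>R v) u" for t
  have h: "(h has_derivative (\<lambda>r. r * f'' (x + a *\<^sub>R u + t *\<^sub>R v) v)) (at t)"
    if t: "0 \<le> t" "t \<le> s" for t
  proof -
    have 1: "x + a *\<^sub>R u + t *\<^sub>R v \<in> S"
      using S[of a t] t a by auto
    have 2: "linear (f'' (x + a *\<^sub>R u + t *\<^sub>R v))"
      using f' 1 has_derivative_linear by blast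
    have "((\<lambda>t. f' (x + a *\<^sub>R u + t *\<^sub>R v) u) has_derivative
        (\<lambda>r. f'' (x + a *\<^sub>R u + t *\<^sub>R v) (r *\<^sub>R v))) (at t)"
      by (rule has_derivative_compose[where f = "\<lambda>t. x + a *\<^sub>R u + t *\<^sub>R v" and g = "\<lambda>y. f' y u",
            OF _ f'[OF 1]]) (auto intro!: derivative_eq_intros)
    then show ?thesis unfolding h_def by (simp add: linear_cmul[OF 2])
  qed
  obtain b where b: "0 < b" "b < s" "h s - h 0 = s * f'' (x + a *\<^sub>R u + b *\<^sub>R v) v"
    using mvt_simple[OF s has_derivative_at_withinI[OF h]] by auto
  show ?thesis
    by (rule that[of a b]) (use a b in \<open>auto simp: g_def h_def\<close>)
qed

lemma small_parallelogram:
  fixes x u v :: "'a::real_normed_vector"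
  assumes "d > 0"
  obtains s where "s > 0"
    "\<And>a b. a \<in> {0..s} \<Longrightarrow> b \<in> {0..s} \<Longrightarrow> x + a *\<^sub>R u + b *\<^sub>R v \<in> ball x d"
proof -
  define s where "s = d / (2 * (norm u + norm v + 1))"
  have pos: "norm u + norm v + 1 > 0" by (simp add: add_nonneg_pos)
  have s: "s > 0" using assms pos by (simp add: s_def)
  have "x + a *\<^sub>R u + b *\<^sub>R v \<in> ball x d" if "a \<in> {0..s}" "b \<in> {0..s}" for a b
  proof -
    have "norm (a *\<^sub>R u + b *\<^sub>R v) \<le> \<bar>a\<bar> * norm u + \<bar>b\<bar> * norm v"
      by (metis norm_scaleR norm_triangle_ineq)
    also have "\<dots> \<le> s * norm u + s * norm v"
      using that by (intro add_mono mult_right_mono) auto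
    also have "\<dots> \<le> s * (norm u + norm v + 1)" using s by (simp add: algebra_simps)
    also have "\<dots> = d / 2" using pos by (simp add: s_def field_simps)
    also have "\<dots> < d" using assms by simp
    finally have "norm (a *\<^sub>R u + b *\<^sub>R v) < d" .
    moreover have "dist x (x + a *\<^sub>R u + b *\<^sub>R v) = norm (a *\<^sub>R u + b *\<^sub>R v)"
      by (metis add.assoc add_diff_cancel_left' dist_commute dist_norm)
    ultimately show ?thesis by simp
  qed
  with s that show ?thesis by blast
qed

lemma symmetric_second_derivative_real:
  fixes f :: "'a::real_normed_vector \<Rightarrow> real"
  assumes S: "open S" "x \<in> S"
    and f: "\<And>y. y \<in> S \<Longrightarrow> (f has_derivative f' y) (at y)"
    and fu: "\<And>y. y \<in> S \<Longrightarrow> ((\<lambda>y. f' y u) has_derivative fu y) (at y)"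
    and fv: "\<And>y. y \<in> S \<Longrightarrow> ((\<lambda>y. f' y v) has_derivative fv y) (at y)"
    and cont: "continuous_on S (\<lambda>y. fu y v)" "continuous_on S (\<lambda>y. fv y u)"
  shows "fu x v = fv x u"
proof (rule ccontr)
  assume ne: "fu x v \<noteq> fv x u"
  define e where "e = \<bar>fu x v - fv x u\<bar> / 2"
  have e: "e > 0" using ne by (simp add: e_def)
  obtain d0 where d0: "d0 > 0" "ball x d0 \<subseteq> S" using S openE by blast
  obtain d1 where d1: "d1 > 0" "\<And>y. y \<in> S \<Longrightarrow> dist y x < d1 \<Longrightarrow> dist (fu y v) (fu x v) < e"
    using cont(1) S(2) e unfolding continuous_on_iff by meson
  obtain d2 where d2: "d2 > 0" "\<And>y. y \<in> S \<Longrightarrow> dist y x < d2 \<Longrightarrow> dist (fv y u) (fv x u) < e"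
    using cont(2) S(2) e unfolding continuous_on_iff by meson
  define d where "d = min d0 (min d1 d2)"
  have "d > 0" using d0 d1 d2 by (simp add: d_def)
  then obtain s where s: "s > 0"
    "\<And>a b. a \<in> {0..s} \<Longrightarrow> b \<in> {0..s} \<Longrightarrow> x + a *\<^sub>R u + b *\<^sub>R v \<in> ball x d"
    using small_parallelogram by blast
  have sub: "ball x d \<subseteq> S" using d0 by (auto simp: d_def)
  obtain a b where ab: "a \<in> {0..s}" "b \<in> {0..s}"
    "f (x + s *\<^sub>R u + s *\<^sub>R v) - f (x + s *\<^sub>R u) - f (x + s *\<^sub>R v) + f x
       = s * (s * fu (x + a *\<^sub>R u + b *\<^sub>R v) v)"
    by (rule second_difference_mean_value[OF s(1), where S = S and f = f and f' = f' and f'' = fu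
          and x = x and u = u and v = v]) (use s(2) sub f fu in auto)
  obtain b' a' where ab': "b' \<in> {0..s}" "a' \<in> {0..s}"
    "f (x + s *\<^sub>R v + s *\<^sub>R u) - f (x + s *\<^sub>R v) - f (x + s *\<^sub>R u) + f x
       = s * (s * fv (x + b' *\<^sub>R v + a' *\<^sub>R u) u)"
  proof (rule second_difference_mean_value[OF s(1), where S = S and f = f and f' = f' and f'' = fv
          and x = x and u = v and v = u])
    fix a b assume "a \<in> {0..s}" "b \<in> {0..s}"
    then show "x + a *\<^sub>R v + b *\<^sub>R u \<in> S" using s(2)[of b a] sub by (auto simp: ac_simps)
  qed (use f fv in auto)
  have "fu (x + a *\<^sub>R u + b *\<^sub>R v) v = fv (x + a' *\<^sub>R u + b' *\<^sub>R v) u"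
  proof -
    have swap: "x + p *\<^sub>R v + q *\<^sub>R u = x + q *\<^sub>R u + p *\<^sub>R v" for p q by simp
    have "s * (s * fu (x + a *\<^sub>R u + b *\<^sub>R v) v) = s * (s * fv (x + a' *\<^sub>R u + b' *\<^sub>R v) u)"
      using ab(3) ab'(3)[unfolded swap] by linarith
    then show ?thesis using s(1) by simp
  qed
  moreover have "dist (fu (x + a *\<^sub>R u + b *\<^sub>R v) v) (fu x v) < e"
    using s(2)[OF ab(1,2)] sub by (intro d1(2)) (auto simp: d_def dist_commute)
  moreover have "dist (fv (x + a' *\<^sub>R u + b' *\<^sub>R v) u) (fv x u) < e"
    using s(2)[OF ab'(2,1)] sub by (intro d2(2)) (auto simp: d_def dist_commute)
  ultimately show False by (simp add: e_def dist_real_def abs_if split: if_splits)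
qed

lemma smooth_on_symmetric_second_derivative:
  fixes f :: "'a::euclidean_space \<Rightarrow> 'b::euclidean_space"
  assumes "smooth_on f S" "open S" "x \<in> S"
  shows "frechet_derivative (\<lambda>y. frechet_derivative f (at y) u) (at x) v
       = frechet_derivative (\<lambda>y. frechet_derivative f (at y) v) (at x) u"
proof (rule euclidean_eqI)
  fix i :: 'b assume "i \<in> Basis"
  let ?D = "\<lambda>w y. frechet_derivative f (at y) w"
  note sm = smooth_on_frechet_derivative[OF assms(1)]
  have "((\<lambda>y. f y \<bullet> i) has_derivative (\<lambda>w. ?D w y \<bullet> i)) (at y)" if "y \<in> S" for y
    using smooth_on_differentiable[OF assms(1) that]
    unfolding frechet_derivative_works by (intro derivative_intros)
  moreover have "((\<lambda>y. ?D w y \<bullet> i) has_derivative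
      (\<lambda>v. frechet_derivative (?D w) (at y) v \<bullet> i)) (at y)" if "y \<in> S" for y w
    using smooth_on_differentiable[OF sm that]
    unfolding frechet_derivative_works by (intro derivative_intros)
  moreover have "continuous_on S (\<lambda>y. frechet_derivative (?D w) (at y) v \<bullet> i)" for w v
    using smooth_on_continuous[OF smooth_on_frechet_derivative[OF sm]] by (intro continuous_intros)
  ultimately show "frechet_derivative (?D u) (at x) v \<bullet> i = frechet_derivative (?D v) (at x) u \<bullet> i"
    by (intro symmetric_second_derivative_real[where f = "\<lambda>y. f y \<bullet> i" and u = u and v = v
          and f' = "\<lambda>y w. ?D w y \<bullet> i" and fu = "\<lambda>y v. frechet_derivative (?D u) (at y) v \<bullet> i"
          and fv = "\<lambda>y w. frechet_derivative (?D v) (at y) w \<bullet> i", OF assms(2,3)])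
qed

text \<open>Expanding the second argument in the standard basis turns the expression into a finite sum of
  products, to which the product rule applies.\<close>

lemma has_derivative_pairing:
  fixes B :: "'a::real_normed_vector \<Rightarrow> 'b::euclidean_space \<Rightarrow> real"
  assumes S: "open S" "x \<in> S"
    and lin: "\<And>y. y \<in> S \<Longrightarrow> linear (B y)"
    and B: "\<And>w. (\<lambda>y. B y w) differentiable (at x)"
    and Z: "Z differentiable (at x)"
  shows "((\<lambda>y. B y (Z y)) has_derivative
     (\<lambda>u. frechet_derivative (\<lambda>y. B y (Z x)) (at x) u + B x (frechet_derivative Z (at x) u))) (at x)"
proof -
  let ?B = "\<lambda>w. frechet_derivative (\<lambda>y. B y w) (at x)"
  let ?Z = "frechet_derivative Z (at x)"
  have expand: "B y w = (\<Sum>i\<in>Basis. (w \<bullet> i) * B y i)" if "y \<in> S" for y w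
  proof -
    have "B y w = B y (\<Sum>i\<in>Basis. (w \<bullet> i) *\<^sub>R i)" by (simp add: euclidean_representation)
    also have "\<dots> = (\<Sum>i\<in>Basis. (w \<bullet> i) * B y i)"
      using lin[OF that] by (simp add: linear_sum linear_cmul)
    finally show ?thesis .
  qed
  have Bi: "((\<lambda>y. B y w) has_derivative ?B w) (at x)" for w
    using B frechet_derivative_works by blast
  have Zx: "(Z has_derivative ?Z) (at x)"
    using Z frechet_derivative_works by blast
  have "((\<lambda>y. \<Sum>i\<in>Basis. (w \<bullet> i) * B y i) has_derivative (\<lambda>u. \<Sum>i\<in>Basis. (w \<bullet> i) * ?B i u)) (at x)"
    for w by (intro has_derivative_sum has_derivative_mult_right Bi)
  then have "((\<lambda>y. B y w) has_derivative (\<lambda>u. \<Sum>i\<in>Basis. (w \<bullet> i) * ?B i u)) (at x)" for w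
    by (rule has_derivative_transform_within_open[OF _ S]) (simp add: expand[symmetric])
  then have B_sum: "?B w u = (\<Sum>i\<in>Basis. (w \<bullet> i) * ?B i u)" for w u
    using Bi has_derivative_unique by metis
  have "((\<lambda>y. \<Sum>i\<in>Basis. (Z y \<bullet> i) * B y i) has_derivative
      (\<lambda>u. \<Sum>i\<in>Basis. (Z x \<bullet> i) * ?B i u + (?Z u \<bullet> i) * B x i)) (at x)"
    by (intro has_derivative_sum has_derivative_mult Bi has_derivative_inner_left Zx)
  then have "((\<lambda>y. B y (Z y)) has_derivative
      (\<lambda>u. \<Sum>i\<in>Basis. (Z x \<bullet> i) * ?B i u + (?Z u \<bullet> i) * B x i)) (at x)"
    by (rule has_derivative_transform_within_open[OF _ S]) (simp add: expand[symmetric])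
  then show ?thesis
    by (rule has_derivative_eq_rhs)
      (simp add: fun_eq_iff sum.distrib B_sum[of "Z x"] expand[OF S(2), of "?Z _"])
qed

lemma frechet_derivative_zero_along_subspace:
  fixes f :: "'a::euclidean_space \<Rightarrow> real"
  assumes "f differentiable (at z)" "open S" "z \<in> S" "subspace W" "u \<in> W"
    and "\<And>y. y \<in> S \<Longrightarrow> y - z \<in> W \<Longrightarrow> f y = 0"
  shows "frechet_derivative f (at z) u = 0"
proof -
  let ?D = "frechet_derivative f (at z)"
  define T where "T = (\<lambda>t. z + t *\<^sub>R u) -` S"
  have T: "open T" "0 \<in> T"
    using assms(2,3) unfolding T_def by (auto intro!: open_vimage continuous_intros)
  have "(f has_derivative ?D) (at (z + 0 *\<^sub>R u))"
    using assms(1) unfolding frechet_derivative_works by simp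
  then have "((\<lambda>t. f (z + t *\<^sub>R u)) has_derivative (\<lambda>h. ?D (h *\<^sub>R u))) (at 0)"
    by (rule has_derivative_compose[where f = "\<lambda>t. z + t *\<^sub>R u", rotated])
      (auto intro!: derivative_eq_intros)
  moreover have "((\<lambda>t. f (z + t *\<^sub>R u)) has_derivative (\<lambda>h. 0)) (at 0)"
    by (rule has_derivative_transform_within_open[OF has_derivative_const[of 0] T])
      (use assms(4-6) in \<open>auto simp: T_def subspace_scale\<close>)
  ultimately have "(\<lambda>h. ?D (h *\<^sub>R u)) = (\<lambda>h. 0)" by (rule has_derivative_unique)
  from fun_cong[OF this, of 1] show ?thesis by simp
qed

section \<open>Linear algebra of families of alternating forms\<close>

text \<open>Used as coordinates along \<open>card I\<close> distinct standard basis vectors, the values of the functionals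
  give a linear embedding of \<open>W\<close> into the span of these vectors; it is onto by comparison of
  dimensions. The bound on \<open>card I\<close> guarantees that there are enough basis vectors. Read
  contrapositively, the first conclusion says that fewer than \<open>dim W\<close> functionals cannot
  separate the points of \<open>W\<close>.\<close>

lemma separating_functionals:
  fixes W :: "'e::euclidean_space set" and l :: "'i \<Rightarrow> 'e \<Rightarrow> real"
  assumes W: "subspace W" and I: "finite I" "card I \<le> dim W"
    and lin: "\<And>i. i \<in> I \<Longrightarrow> linear (l i)"
    and sep: "\<And>w. w \<in> W \<Longrightarrow> (\<And>i. i \<in> I \<Longrightarrow> l i w = 0) \<Longrightarrow> w = 0"
  shows "dim W = card I" "\<exists>w\<in>W. \<forall>i\<in>I. l i w = c i"
proof -
  have "card I \<le> DIM('e)" using I(2) dim_subset_UNIV le_trans by blast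
  then obtain \<beta> where \<beta>: "\<beta> ` I \<subseteq> (Basis :: 'e set)" "inj_on \<beta> I"
    using card_le_inj[OF I(1), of "Basis :: 'e set"] by auto
  have orthonormal: "\<beta> i \<bullet> \<beta> j = (if i = j then 1 else 0)" if "i \<in> I" "j \<in> I" for i j
  proof -
    have "\<beta> i \<in> Basis" "\<beta> j \<in> Basis" using \<beta>(1) that by auto
    moreover have "\<beta> i = \<beta> j \<longleftrightarrow> i = j" using inj_on_eq_iff[OF \<beta>(2) that] .
    ultimately show ?thesis using inner_Basis by metis
  qed
  define T where "T w = (\<Sum>i\<in>I. l i w *\<^sub>R \<beta> i)" for w
  have T: "linear T"
    by (rule linearI)
      (simp_all add: T_def linear_add[OF lin] linear_cmul[OF lin] scaleR_add_left sum.distrib scaleR_sum_right)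
  have coef: "T w \<bullet> \<beta> j = l j w" if "j \<in> I" for w j
  proof -
    have "T w \<bullet> \<beta> j = (\<Sum>i\<in>I. l i w * (\<beta> i \<bullet> \<beta> j))" by (simp add: T_def inner_sum_left)
    also have "\<dots> = (\<Sum>i\<in>I. if i = j then l i w else 0)"
    proof (rule sum.cong[OF refl])
      fix i assume "i \<in> I"
      then show "l i w * (\<beta> i \<bullet> \<beta> j) = (if i = j then l i w else 0)"
        using orthonormal that by simp
    qed
    also have "\<dots> = l j w" using I(1) that by simp
    finally show ?thesis .
  qed
  have inj: "inj_on T W"
  proof (rule inj_onI)
    fix u v assume uv: "u \<in> W" "v \<in> W" "T u = T v"
    have "u - v = 0"
    proof (rule sep)
      show "u - v \<in> W" using uv W by (simp add: subspace_diff)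
      fix i assume i: "i \<in> I"
      then have "l i u = l i v" using coef uv(3) by metis
      then show "l i (u - v) = 0" using lin[OF i] by (simp add: linear_diff)
    qed
    then show "u = v" by simp
  qed
  have dimT: "dim (T ` W) = dim W"
  proof (rule dim_image_eq[OF T])
    show "inj_on T (span W)" using inj W by (metis span_eq_iff)
  qed
  have sub: "T ` W \<subseteq> span (\<beta> ` I)"
  proof (rule image_subsetI)
    fix w
    show "T w \<in> span (\<beta> ` I)" unfolding T_def by (intro span_sum span_scale span_base) auto
  qed
  have "dim (span (\<beta> ` I)) \<le> card I"
    using I(1) by (metis card_image_le dim_le_card' dim_span finite_imageI le_trans)
  moreover have "dim (T ` W) \<le> dim (span (\<beta> ` I))" using sub dim_subset by blast
  ultimately have dims: "dim W = card I" "dim (span (\<beta> ` I)) \<le> dim (T ` W)"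
    using dimT I(2) by auto
  show "dim W = card I" by (rule dims(1))
  have TW: "T ` W = span (\<beta> ` I)"
    using subspace_dim_equal[OF linear_subspace_image[OF T W] subspace_span sub dims(2)] .
  have "(\<Sum>i\<in>I. c i *\<^sub>R \<beta> i) \<in> T ` W"
    unfolding TW by (intro span_sum span_scale span_base) auto
  then obtain w where w: "w \<in> W" "T w = (\<Sum>i\<in>I. c i *\<^sub>R \<beta> i)" by auto
  have "l j w = c j" if j: "j \<in> I" for j
  proof -
    have "l j w = (\<Sum>i\<in>I. c i *\<^sub>R \<beta> i) \<bullet> \<beta> j" using coef[OF j] w(2) by metis
    also have "\<dots> = (\<Sum>i\<in>I. if i = j then c i else 0)"
      unfolding inner_sum_left
    proof (rule sum.cong[OF refl])
      fix i assume "i \<in> I"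
      then show "(c i *\<^sub>R \<beta> i) \<bullet> \<beta> j = (if i = j then c i else 0)"
        using orthonormal j by simp
    qed
    finally show ?thesis using I(1) j by simp
  qed
  with w(1) show "\<exists>w\<in>W. \<forall>i\<in>I. l i w = c i" by blast
qed

lemma orthogonal_direct_sum:
  fixes V W :: "'e::euclidean_space set"
  assumes "subspace V" "subspace W" "W \<subseteq> V"
  obtains F where "direct_sum V W F" "dim W + dim F = dim V"
proof -
  define F where "F = {y \<in> V. \<forall>x\<in>W. orthogonal x y}"
  have F: "subspace F"
    using assms(1) unfolding F_def subspace_def
    by (auto simp: orthogonal_clauses)
  have int: "W \<inter> F = {0}"
    using subspace_0[OF assms(1)] subspace_0[OF assms(2)]
    by (auto simp: F_def orthogonal_clauses orthogonal_self)
  have "{a + b | a b. a \<in> W \<and> b \<in> F} = V"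
  proof
    show "{a + b | a b. a \<in> W \<and> b \<in> F} \<subseteq> V"
      using assms by (auto simp: F_def intro!: subspace_add)
  next
    show "V \<subseteq> {a + b | a b. a \<in> W \<and> b \<in> F}"
    proof
      fix v assume v: "v \<in> V"
      obtain a b where ab: "a \<in> span W" "\<And>w. w \<in> span W \<Longrightarrow> orthogonal b w" "v = a + b"
        using orthogonal_subspace_decomp_exists[of W v] by blast
      have a: "a \<in> W" using ab(1) assms(2) span_eq_iff by metis
      have "b = v - a" using ab(3) by simp
      then have "b \<in> V" using v a assms by (auto intro: subspace_diff)
      moreover have "orthogonal x b" if "x \<in> W" for x
        using ab(2)[OF span_base[OF that]] by (simp add: orthogonal_commute)
      ultimately show "v \<in> {a + b | a b. a \<in> W \<and> b \<in> F}" using a ab(3) F_def by auto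
    qed
  qed
  note sum = this
  have "dim V + dim (W \<inter> F) = dim W + dim F"
    using dim_sums_Int[OF assms(2) F] sum by simp
  then have "dim W + dim F = dim V" by (simp add: int)
  with that[of F] show ?thesis using assms(2) F int sum by (simp add: direct_sum_def)
qed

locale alternating_forms =
  fixes V :: "'e::euclidean_space set" and k :: nat and \<omega> :: "nat \<Rightarrow> 'e \<Rightarrow> 'e \<Rightarrow> real"
  assumes V: "subspace V"
    and lin: "a < k \<Longrightarrow> linear (\<omega> a u)"
    and alt: "a < k \<Longrightarrow> \<omega> a u v = - \<omega> a v u"
    and nondeg: "v \<in> V \<Longrightarrow> (\<And>a w. a < k \<Longrightarrow> w \<in> V \<Longrightarrow> \<omega> a v w = 0) \<Longrightarrow> v = 0"
begin

lemma lin_left: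
  assumes "a < k"
  shows "linear (\<lambda>u. \<omega> a u v)"
proof -
  have "(\<lambda>u. \<omega> a u v) = (\<lambda>u. - \<omega> a v u)" by (rule ext) (rule alt[OF assms])
  then show ?thesis using linear_compose_neg[OF lin[OF assms]] by (simp only:)
qed

definition totally_isotropic :: "'e set \<Rightarrow> bool" where
  "totally_isotropic E \<longleftrightarrow> subspace E \<and> E \<subseteq> V \<and> (\<forall>a<k. \<forall>u\<in>E. \<forall>v\<in>E. \<omega> a u v = 0)"

text \<open>The forms pair \<open>E\<close> with its complement \<open>F\<close>: as they vanish on \<open>E\<close>, nondegeneracy
  makes the resulting map from \<open>E\<close> to the \<open>k\<close>-fold power of the dual of \<open>F\<close> injective.\<close>

lemma complement_separates:
  assumes E: "totally_isotropic E" and F: "direct_sum V E F" and B: "F \<subseteq> span B"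
    and w: "w \<in> E" "\<And>a b. a < k \<Longrightarrow> b \<in> B \<Longrightarrow> \<omega> a w b = 0"
  shows "w = 0"
proof (rule nondeg)
  show "w \<in> V" using E w(1) unfolding totally_isotropic_def by blast
  fix a v assume a: "a < k" and v: "v \<in> V"
  obtain e f where ef: "e \<in> E" "f \<in> F" "v = e + f"
    using F v unfolding direct_sum_def by blast
  have "\<omega> a w f = 0"
  proof (rule linear_eq_0_on_span[OF lin[OF a]])
    show "\<omega> a w b = 0" if "b \<in> B" for b using w(2)[OF a that] .
    show "f \<in> span B" using ef(2) B by blast
  qed
  moreover have "\<omega> a w e = 0" using E a ef(1) w(1) unfolding totally_isotropic_def by blast
  ultimately show "\<omega> a w v = 0" using lin[OF a] ef(3) by (simp add: linear_add)
qed

lemma totally_isotropic_dim_le: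
  assumes E: "totally_isotropic E" and F: "direct_sum V E F"
  shows "dim E \<le> k * dim F"
proof (rule ccontr)
  assume less: "\<not> dim E \<le> k * dim F"
  obtain B where B: "B \<subseteq> F" "independent B" "F \<subseteq> span B" "card B = dim F"
    using basis_exists by blast
  have finB: "finite B" using B(2) independent_imp_finite by blast
  have card: "card ({..<k} \<times> B) = k * dim F" using B(4) by (simp add: card_cartesian_product)
  have "dim E = card ({..<k} \<times> B)"
  proof (rule separating_functionals(1)[where l = "\<lambda>(a, b) w. \<omega> a w b"])
    show "subspace E" using E totally_isotropic_def by blast
    show "finite ({..<k} \<times> B)" using finB by simp
    show "card ({..<k} \<times> B) \<le> dim E" using less card by simp
    show "linear ((\<lambda>(a, b) w. \<omega> a w b) i)" if "i \<in> {..<k} \<times> B" for i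
      using that lin_left by auto
    show "w = 0" if "w \<in> E" "\<And>i. i \<in> {..<k} \<times> B \<Longrightarrow> (\<lambda>(a, b) w. \<omega> a w b) i w = 0" for w
      using complement_separates[OF E F B(3) that(1)] that(2)[of "(_, _)"] by simp
  qed
  with less card show False by simp
qed

text \<open>When the dimensions agree, the pairing is a bijection, so a complement \<open>F\<close> can be sheared along
  \<open>E\<close> to absorb the values of the forms on \<open>F\<close>: replace \<open>f\<close> by \<open>f + w\<close> with \<open>w\<close> in \<open>E\<close>
  and \<open>\<omega> a w g = - \<omega> a f g / 2\<close> for all \<open>g\<close> in \<open>F\<close>. Both arguments being sheared, each contributes half of
  the correction.\<close>

lemma totally_isotropic_complement:
  assumes E: "totally_isotropic E" and F: "direct_sum V E F" and dim: "dim E = k * dim F"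
  obtains F' where "totally_isotropic F'" "direct_sum V E F'"
proof -
  obtain B where B: "B \<subseteq> F" "independent B" "F \<subseteq> span B" "card B = dim F"
    using basis_exists by blast
  have finB: "finite B" using B(2) independent_imp_finite by blast
  have subE: "subspace E" and EV: "E \<subseteq> V" and E0: "\<And>a u v. a < k \<Longrightarrow> u \<in> E \<Longrightarrow> v \<in> E \<Longrightarrow> \<omega> a u v = 0"
    using E unfolding totally_isotropic_def by auto
  have subF: "subspace F" and int: "E \<inter> F = {0}" and sum: "{a + b | a b. a \<in> E \<and> b \<in> F} = V"
    using F unfolding direct_sum_def by auto
  have FV: "F \<subseteq> V"
  proof
    fix f assume "f \<in> F"
    then have "0 + f \<in> {a + b | a b. a \<in> E \<and> b \<in> F}" using subspace_0[OF subE] by blast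
    then show "f \<in> V" using sum by simp
  qed
  have shear: "\<exists>w\<in>E. \<forall>a<k. \<forall>g\<in>F. \<omega> a w g = - (1/2) * \<omega> a f g" for f
  proof -
    have "\<exists>w\<in>E. \<forall>i\<in>{..<k} \<times> B. (\<lambda>(a, b) w. \<omega> a w b) i w = (\<lambda>(a, b). - (1/2) * \<omega> a f b) i"
    proof (rule separating_functionals(2))
      show "subspace E" by (rule subE)
      show "finite ({..<k} \<times> B)" using finB by simp
      show "card ({..<k} \<times> B) \<le> dim E" using dim B(4) by (simp add: card_cartesian_product)
      show "linear ((\<lambda>(a, b) w. \<omega> a w b) i)" if "i \<in> {..<k} \<times> B" for i
        using that lin_left by auto
      show "w = 0" if "w \<in> E" "\<And>i. i \<in> {..<k} \<times> B \<Longrightarrow> (\<lambda>(a, b) w. \<omega> a w b) i w = 0" for w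
        using complement_separates[OF E F B(3) that(1)] that(2)[of "(_, _)"] by simp
    qed
    then obtain w where w: "w \<in> E" "\<And>a b. a < k \<Longrightarrow> b \<in> B \<Longrightarrow> \<omega> a w b = - (1/2) * \<omega> a f b"
      by auto
    have "\<omega> a w g = - (1/2) * \<omega> a f g" if a: "a < k" and g: "g \<in> F" for a g
    proof -
      have "linear (\<lambda>g. \<omega> a w g + (1/2) *\<^sub>R \<omega> a f g)"
        by (intro linear_compose_add linear_compose_scale_right lin[OF a])
      then have "\<omega> a w g + (1/2) *\<^sub>R \<omega> a f g = 0"
        by (rule linear_eq_0_on_span[of _ B]) (use w(2)[OF a] g B(3) in auto)
      then show ?thesis by simp
    qed
    with w(1) show ?thesis by blast
  qed
  define F' where "F' = {f + w | f w. f \<in> F \<and> w \<in> E \<and> (\<forall>a<k. \<forall>g\<in>F. \<omega> a w g = - (1/2) * \<omega> a f g)}"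
  have F': "subspace F'"
    unfolding subspace_def
  proof (intro conjI ballI allI)
    have "\<omega> a 0 g = 0" if "a < k" for a g using linear_0[OF lin_left[OF that]] .
    then show "0 \<in> F'" unfolding F'_def using subspace_0[OF subE] subspace_0[OF subF] by force
  next
    fix x y assume "x \<in> F'" "y \<in> F'"
    then obtain f w f1 w1 where fw: "x = f + w" "f \<in> F" "w \<in> E" "\<forall>a<k. \<forall>g\<in>F. \<omega> a w g = - (1/2) * \<omega> a f g"
      "y = f1 + w1" "f1 \<in> F" "w1 \<in> E" "\<forall>a<k. \<forall>g\<in>F. \<omega> a w1 g = - (1/2) * \<omega> a f1 g"
      unfolding F'_def by blast
    have "\<omega> a (w + w1) g = - (1/2) * \<omega> a (f + f1) g" if "a < k" "g \<in> F" for a g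
      using fw(4,8) that by (simp add: linear_add[OF lin_left] add_divide_distrib)
    moreover have "x + y = (f + f1) + (w + w1)" using fw by simp
    moreover have "f + f1 \<in> F" "w + w1 \<in> E" using fw subE subF by (simp_all add: subspace_add)
    ultimately show "x + y \<in> F'" unfolding F'_def by blast
  next
    fix c x assume "x \<in> F'"
    then obtain f w where fw: "x = f + w" "f \<in> F" "w \<in> E" "\<forall>a<k. \<forall>g\<in>F. \<omega> a w g = - (1/2) * \<omega> a f g"
      unfolding F'_def by blast
    have "\<omega> a (c *\<^sub>R w) g = - (1/2) * \<omega> a (c *\<^sub>R f) g" if "a < k" "g \<in> F" for a g
      using fw(4) that by (simp add: linear_cmul[OF lin_left])
    moreover have "c *\<^sub>R x = c *\<^sub>R f + c *\<^sub>R w" using fw by (simp add: scaleR_add_right)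
    moreover have "c *\<^sub>R f \<in> F" "c *\<^sub>R w \<in> E" using fw subE subF by (simp_all add: subspace_scale)
    ultimately show "c *\<^sub>R x \<in> F'" unfolding F'_def by blast
  qed
  have "\<omega> a x y = 0" if a: "a < k" and xy: "x \<in> F'" "y \<in> F'" for a x y
  proof -
    obtain f w g z where fw: "x = f + w" "f \<in> F" "w \<in> E" "\<forall>a<k. \<forall>g\<in>F. \<omega> a w g = - (1/2) * \<omega> a f g"
      "y = g + z" "g \<in> F" "z \<in> E" "\<forall>a<k. \<forall>f\<in>F. \<omega> a z f = - (1/2) * \<omega> a g f"
      using xy unfolding F'_def by blast
    have "\<omega> a x y = \<omega> a f g + \<omega> a f z + \<omega> a w g + \<omega> a w z"
      unfolding fw(1,5) by (simp add: linear_add[OF lin[OF a]] linear_add[OF lin_left[OF a]])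
    moreover have "\<omega> a w z = 0" using E0 a fw by blast
    moreover have "\<omega> a w g = - (1/2) * \<omega> a f g" using fw a by blast
    moreover have "\<omega> a f z = - (1/2) * \<omega> a f g"
      using fw(8) a fw(2) alt[OF a, of f z] alt[OF a, of f g] by simp
    ultimately show ?thesis by simp
  qed
  moreover have "F' \<subseteq> V"
    unfolding F'_def using EV FV V by (auto intro: subspace_add)
  ultimately have "totally_isotropic F'" using F' unfolding totally_isotropic_def by blast
  moreover have "direct_sum V E F'"
    unfolding direct_sum_def
  proof (intro conjI)
    show "subspace E" "subspace F'" by (fact subE, fact F')
    show "E \<inter> F' = {0}"
    proof -
      have "x = 0" if "x \<in> E" "x \<in> F'" for x
      proof -
        obtain f w where fw: "x = f + w" "f \<in> F" "w \<in> E" "\<forall>a<k. \<forall>g\<in>F. \<omega> a w g = - (1/2) * \<omega> a f g"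
          using \<open>x \<in> F'\<close> unfolding F'_def by blast
        have "f = x - w" using fw(1) by simp
        then have "f \<in> E" using that(1) fw(3) subE by (simp add: subspace_diff)
        then have f: "f = 0" using fw(2) int by blast
        have "w = 0"
        proof (rule complement_separates[OF E F _ fw(3)])
          show "F \<subseteq> span F" by (rule span_superset)
          show "\<omega> a w g = 0" if "a < k" "g \<in> F" for a g
            using fw(4) that f linear_0[OF lin_left[OF that(1)]] by simp
        qed
        with f fw(1) show ?thesis by simp
      qed
      then show ?thesis using subspace_0[OF subE] subspace_0[OF F'] by blast
    qed
    show "{a + b | a b. a \<in> E \<and> b \<in> F'} = V"
    proof
      show "{a + b | a b. a \<in> E \<and> b \<in> F'} \<subseteq> V"
        using EV \<open>F' \<subseteq> V\<close> V by (auto intro: subspace_add)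
      show "V \<subseteq> {a + b | a b. a \<in> E \<and> b \<in> F'}"
      proof
        fix v assume "v \<in> V"
        then obtain e f where ef: "e \<in> E" "f \<in> F" "v = e + f" using sum by blast
        obtain w where w: "w \<in> E" "\<forall>a<k. \<forall>g\<in>F. \<omega> a w g = - (1/2) * \<omega> a f g" using shear by blast
        have "f + w \<in> F'" unfolding F'_def using ef w by blast
        moreover have "e - w \<in> E" using ef w subE by (simp add: subspace_diff)
        moreover have "v = (e - w) + (f + w)" using ef by simp
        ultimately show "v \<in> {a + b | a b. a \<in> E \<and> b \<in> F'}" by blast
      qed
    qed
  qed
  ultimately show ?thesis by (rule that)
qed

end

section \<open>Charts and tensors in coordinates\<close>

abbreviation transition_deriv ::
    "('m, 'e::euclidean_space) chart \<Rightarrow> ('m, 'e) chart \<Rightarrow> 'm \<Rightarrow> 'e \<Rightarrow> 'e" where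
  "transition_deriv c c' p \<equiv> frechet_derivative (transition c c') (at (coord c p))"

locale manifold_with_atlas =
  fixes M :: "'m topology" and A :: "('m, 'e::euclidean_space) chart set"
  assumes manifold: "smooth_manifold M A"
begin

lemma atlas_is_chart: "c \<in> A \<Longrightarrow> is_chart M c"
  and atlas_compatible: "c \<in> A \<Longrightarrow> c' \<in> A \<Longrightarrow> compatible c c'"
  using manifold unfolding smooth_manifold_def by blast+

lemma cdom_topspace:
  assumes "c \<in> A"
  shows "cdom c \<subseteq> topspace M"
  using atlas_is_chart[OF assms] openin_subset unfolding is_chart_def by blast

lemma topspace_cdom:
  assumes "c \<in> A"
  shows "topspace (subtopology M (cdom c)) = cdom c"
  using cdom_topspace[OF assms] by auto

lemma coord_inv_coord:
  assumes "c \<in> A" "p \<in> cdom c"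
  shows "coord_inv c (coord c p) = p"
proof -
  have "inj_on (coord c) (cdom c)"
    using atlas_is_chart[OF assms(1)] homeomorphic_imp_injective_map topspace_cdom[OF assms(1)]
    unfolding is_chart_def by metis
  then show ?thesis unfolding coord_inv_def using assms(2) by simp
qed

lemma open_coord_image:
  assumes "c \<in> A" "openin M U"
  shows "open (coord c ` (U \<inter> cdom c))"
proof -
  have c: "open (coord c ` cdom c)"
    "open_map (subtopology M (cdom c)) (top_of_set (coord c ` cdom c)) (coord c)"
    using atlas_is_chart[OF assms(1)] homeomorphic_imp_open_map unfolding is_chart_def by blast+
  have "openin (subtopology M (cdom c)) (U \<inter> cdom c)"
    using assms(2) openin_subtopology by blast
  then have "openin (top_of_set (coord c ` cdom c)) (coord c ` (U \<inter> cdom c))"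
    using c(2) unfolding open_map_def by blast
  then show ?thesis using c(1) openin_open_trans by blast
qed

lemma chart_at:
  assumes "x \<in> topspace M"
  shows "chart_at A x \<in> A" "x \<in> cdom (chart_at A x)"
proof -
  have "\<exists>c. c \<in> A \<and> x \<in> cdom c"
    using manifold assms unfolding smooth_manifold_def by blast
  then have "chart_at A x \<in> A \<and> x \<in> cdom (chart_at A x)"
    unfolding chart_at_def by (rule someI_ex)
  then show "chart_at A x \<in> A" "x \<in> cdom (chart_at A x)" by auto
qed

lemma transition_coord:
  assumes "c \<in> A" "p \<in> cdom c"
  shows "transition c c' (coord c p) = coord c' p"
  using coord_inv_coord[OF assms] by (simp add: transition_def)

lemma transition_domain:
  assumes "c \<in> A" "c' \<in> A"
  shows "open (coord c ` (cdom c' \<inter> cdom c))" "smooth_on (transition c c') (coord c ` (cdom c' \<inter> cdom c))"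
proof -
  show "open (coord c ` (cdom c' \<inter> cdom c))"
    using open_coord_image[OF assms(1)] atlas_is_chart[OF assms(2)] unfolding is_chart_def by blast
  show "smooth_on (transition c c') (coord c ` (cdom c' \<inter> cdom c))"
    using atlas_compatible[OF assms] unfolding compatible_def by (simp add: Int_commute)
qed

lemma transition_differentiable:
  assumes "c \<in> A" "c' \<in> A" "p \<in> cdom c" "p \<in> cdom c'"
  shows "transition c c' differentiable (at (coord c p))"
  using smooth_on_differentiable[OF transition_domain(2)[OF assms(1,2)]] assms(3,4) by blast

lemma linear_transition_deriv:
  assumes "c \<in> A" "c' \<in> A" "p \<in> cdom c" "p \<in> cdom c'"
  shows "linear (transition_deriv c c' p)"
  by (rule linear_frechet_derivative[OF transition_differentiable[OF assms]])

lemma transition_deriv_self: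
  assumes "c \<in> A" "p \<in> cdom c"
  shows "transition_deriv c c p = id"
proof -
  have "(transition c c has_derivative (\<lambda>v. v)) (at (coord c p))"
  proof (rule has_derivative_transform_within_open[OF has_derivative_ident transition_domain(1)[OF assms(1,1)]])
    show "coord c p \<in> coord c ` (cdom c \<inter> cdom c)" using assms(2) by blast
    fix z assume "z \<in> coord c ` (cdom c \<inter> cdom c)"
    then obtain q where "z = coord c q" "q \<in> cdom c" by blast
    then show "z = transition c c z" by (simp add: transition_coord[OF assms(1)])
  qed
  from frechet_derivative_at[OF this] show ?thesis by (simp add: id_def)
qed

lemma transition_deriv_compose:
  assumes c: "c \<in> A" "p \<in> cdom c" and c': "c' \<in> A" "p \<in> cdom c'" and c'': "c'' \<in> A" "p \<in> cdom c''"
  shows "transition_deriv c' c'' p (transition_deriv c c' p w) = transition_deriv c c'' p w"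
proof -
  have eq: "transition c c' (coord c p) = coord c' p" using c transition_coord by blast
  have d: "transition c c' differentiable at (coord c p)"
    "transition c' c'' differentiable at (transition c c' (coord c p))"
    using transition_differentiable c c' c'' eq by auto
  have "openin M (cdom c' \<inter> cdom c'')"
    using atlas_is_chart c'(1) c''(1) unfolding is_chart_def by blast
  then have op: "open (coord c ` ((cdom c' \<inter> cdom c'') \<inter> cdom c))"
    by (rule open_coord_image[OF c(1)])
  have "frechet_derivative (transition c' c'' \<circ> transition c c') (at (coord c p))
      = transition_deriv c c'' p"
  proof (rule frechet_derivative_transform_within_open[OF differentiable_chain_at[OF d] op])
    show "coord c p \<in> coord c ` ((cdom c' \<inter> cdom c'') \<inter> cdom c)" using c c' c'' by blast
    fix z assume "z \<in> coord c ` ((cdom c' \<inter> cdom c'') \<inter> cdom c)"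
    then obtain q where "z = coord c q" "q \<in> cdom c" "q \<in> cdom c'" by blast
    then show "(transition c' c'' \<circ> transition c c') z = transition c c'' z"
      using c(1) c'(1) by (simp add: transition_coord)
  qed
  then show ?thesis using frechet_derivative_compose[OF d] eq by (metis comp_apply)
qed

lemma chart_deriv_inverse:
  assumes "c \<in> A" "p \<in> cdom c"
  shows "chart_deriv A c p (chart_deriv_inv A c p w) = w"
    "chart_deriv_inv A c p (chart_deriv A c p w) = w"
proof -
  have p: "p \<in> topspace M" using assms cdom_topspace by blast
  show "chart_deriv A c p (chart_deriv_inv A c p w) = w"
    "chart_deriv_inv A c p (chart_deriv A c p w) = w"
    using transition_deriv_compose[OF assms chart_at[OF p] assms]
      transition_deriv_compose[OF chart_at[OF p] assms chart_at[OF p]]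
      transition_deriv_self[OF assms] transition_deriv_self[OF chart_at[OF p]]
    unfolding chart_deriv_def chart_deriv_inv_def by auto
qed

lemma chart_deriv_chart_at:
  assumes "x \<in> topspace M"
  shows "chart_deriv A (chart_at A x) x = id" "chart_deriv_inv A (chart_at A x) x = id"
  using transition_deriv_self[OF chart_at[OF assms]]
  unfolding chart_deriv_def chart_deriv_inv_def by auto

lemma form_rep_coord:
  assumes "c \<in> A" "p \<in> cdom c"
  shows "form_rep A c \<alpha> (coord c p) w = \<alpha> p (chart_deriv_inv A c p w)"
  using coord_inv_coord[OF assms] by (simp add: form_rep_def)

lemma form_rep_transition:
  assumes c: "c \<in> A" "p \<in> cdom c" and c': "c' \<in> A" "p \<in> cdom c'"
  shows "form_rep A c \<alpha> (coord c p) w = form_rep A c' \<alpha> (coord c' p) (transition_deriv c c' p w)"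
proof -
  have p: "p \<in> topspace M" using assms cdom_topspace by blast
  show ?thesis
    unfolding form_rep_coord[OF c] form_rep_coord[OF c'] chart_deriv_inv_def
    by (simp add: transition_deriv_compose[OF c c' chart_at[OF p]])
qed

lemma linear_form_rep:
  assumes "c \<in> A" "smooth_one_form A U \<alpha>" "y \<in> coord c ` (U \<inter> cdom c)"
  shows "linear (form_rep A c \<alpha> y)"
proof -
  obtain p where p: "y = coord c p" "p \<in> U" "p \<in> cdom c" using assms(3) by blast
  have pM: "p \<in> topspace M" using p assms(1) cdom_topspace by blast
  have "linear (\<alpha> p)" using assms(2) p(2) unfolding smooth_one_form_def by blast
  moreover have "linear (chart_deriv_inv A c p)"
    unfolding chart_deriv_inv_def using linear_transition_deriv chart_at[OF pM] assms(1) p(3) by blast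
  ultimately have "linear (\<alpha> p \<circ> chart_deriv_inv A c p)" using linear_compose by blast
  moreover have "form_rep A c \<alpha> y = \<alpha> p \<circ> chart_deriv_inv A c p"
    unfolding p(1) using form_rep_coord[OF assms(1) p(3)] by auto
  ultimately show ?thesis by simp
qed

lemma form_rep_differentiable:
  assumes "c \<in> A" "smooth_one_form A U \<alpha>" "y \<in> coord c ` (U \<inter> cdom c)"
  shows "(\<lambda>y. form_rep A c \<alpha> y w) differentiable (at y)"
  using assms smooth_on_differentiable unfolding smooth_one_form_def by metis

lemma vf_rep_differentiable:
  assumes "c \<in> A" "smooth_vf A U X" "y \<in> coord c ` (U \<inter> cdom c)"
  shows "vf_rep A c X differentiable (at y)"
  using assms smooth_on_differentiable unfolding smooth_vf_def by metis

lemma ext_deriv_alternating: "ext_deriv A \<alpha> x u v = - ext_deriv A \<alpha> x v u"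
  by (simp add: ext_deriv_def Let_def)

lemma linear_ext_deriv:
  assumes "openin M U" "smooth_one_form A U \<alpha>" "x \<in> U"
  shows "linear (ext_deriv A \<alpha> x u)"
proof -
  let ?c = "chart_at A x"
  let ?y = "coord ?c x"
  let ?D = "\<lambda>w. frechet_derivative (\<lambda>y. form_rep A ?c \<alpha> y w) (at ?y)"
  have x: "x \<in> topspace M" using assms openin_subset by blast
  have op: "open (coord ?c ` (U \<inter> cdom ?c))" by (rule open_coord_image[OF chart_at(1)[OF x] assms(1)])
  have y: "?y \<in> coord ?c ` (U \<inter> cdom ?c)" using assms(3) chart_at(2)[OF x] by blast
  note lin = linear_form_rep[OF chart_at(1)[OF x] assms(2)]
  have hd: "((\<lambda>y. form_rep A ?c \<alpha> y w) has_derivative ?D w) (at ?y)" for w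
    using form_rep_differentiable[OF chart_at(1)[OF x] assms(2) y] frechet_derivative_works by blast
  have "((\<lambda>y. form_rep A ?c \<alpha> y (v + w)) has_derivative (\<lambda>u. ?D v u + ?D w u)) (at ?y)" for v w
    by (rule has_derivative_transform_within_open[OF has_derivative_add[OF hd hd] op y])
      (simp add: linear_add[OF lin])
  then have add: "?D (v + w) = (\<lambda>u. ?D v u + ?D w u)" for v w
    by (rule frechet_derivative_at[symmetric])
  have "((\<lambda>y. form_rep A ?c \<alpha> y (r *\<^sub>R w)) has_derivative (\<lambda>u. r *\<^sub>R ?D w u)) (at ?y)" for r w
    by (rule has_derivative_transform_within_open[OF has_derivative_scaleR_right[OF hd] op y])
      (simp add: linear_cmul[OF lin])
  then have scale: "?D (r *\<^sub>R w) = (\<lambda>u. r *\<^sub>R ?D w u)" for r w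
    by (rule frechet_derivative_at[symmetric])
  have lu: "linear (?D u)" using has_derivative_linear[OF hd] .
  show ?thesis
    by (rule linearI) (simp_all add: ext_deriv_def Let_def add scale linear_add[OF lu] linear_cmul[OF lu]
        algebra_simps)
qed

text \<open>In the chosen chart at \<open>x\<close>, the functions \<open>\<alpha> X\<close> and \<open>\<alpha> Y\<close> vanish on \<open>U\<close>; differentiating
  the first along \<open>Y\<close> and the second along \<open>X\<close> and subtracting gives the formula.\<close>

lemma form_lie_bracket:
  assumes U: "openin M U" "x \<in> U" and \<alpha>: "smooth_one_form A U \<alpha>"
    and X: "smooth_vf A U X" "\<And>y. y \<in> U \<Longrightarrow> \<alpha> y (X y) = 0"
    and Y: "smooth_vf A U Y" "\<And>y. y \<in> U \<Longrightarrow> \<alpha> y (Y y) = 0"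
  shows "\<alpha> x (lie_bracket A X Y x) = - ext_deriv A \<alpha> x (X x) (Y x)"
proof -
  let ?c = "chart_at A x"
  let ?y = "coord ?c x"
  let ?S = "coord ?c ` (U \<inter> cdom ?c)"
  let ?B = "form_rep A ?c \<alpha>"
  have x: "x \<in> topspace M" using U openin_subset by blast
  note c = chart_at[OF x]
  have S: "open ?S" "?y \<in> ?S" using open_coord_image[OF c(1) U(1)] U(2) c(2) by auto
  have at_x: "vf_rep A ?c Z ?y = Z x" "?B ?y = \<alpha> x" for Z
    using coord_inv_coord[OF c] chart_deriv_chart_at[OF x] by (auto simp: vf_rep_def form_rep_def)
  have key: "frechet_derivative (\<lambda>y. ?B y (Z x)) (at ?y) u
      + \<alpha> x (frechet_derivative (vf_rep A ?c Z) (at ?y) u) = 0"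
    if Z: "smooth_vf A U Z" "\<And>y. y \<in> U \<Longrightarrow> \<alpha> y (Z y) = 0" for Z u
  proof -
    have "((\<lambda>y. ?B y (vf_rep A ?c Z y)) has_derivative
       (\<lambda>u. frechet_derivative (\<lambda>y. ?B y (vf_rep A ?c Z ?y)) (at ?y) u
          + ?B ?y (frechet_derivative (vf_rep A ?c Z) (at ?y) u))) (at ?y)"
      using S linear_form_rep[OF c(1) \<alpha>] form_rep_differentiable[OF c(1) \<alpha> S(2)]
        vf_rep_differentiable[OF c(1) Z(1) S(2)]
      by (intro has_derivative_pairing) auto
    moreover have "((\<lambda>y. ?B y (vf_rep A ?c Z y)) has_derivative (\<lambda>u. 0)) (at ?y)"
    proof (rule has_derivative_transform_within_open[OF has_derivative_const[of 0] S])
      fix y assume "y \<in> ?S"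
      then obtain p where p: "y = coord ?c p" "p \<in> U" "p \<in> cdom ?c" by blast
      show "0 = ?B y (vf_rep A ?c Z y)"
        unfolding p(1) form_rep_coord[OF c(1) p(3)] vf_rep_def coord_inv_coord[OF c(1) p(3)]
        using chart_deriv_inverse(2)[OF c(1) p(3)] Z(2)[OF p(2)] by simp
    qed
    ultimately have "(\<lambda>u. frechet_derivative (\<lambda>y. ?B y (vf_rep A ?c Z ?y)) (at ?y) u
          + ?B ?y (frechet_derivative (vf_rep A ?c Z) (at ?y) u)) = (\<lambda>u. 0)"
      by (rule has_derivative_unique)
    from fun_cong[OF this, of u] show ?thesis unfolding at_x .
  qed
  have "linear (\<alpha> x)" using \<alpha> U(2) unfolding smooth_one_form_def by blast
  then have "\<alpha> x (lie_bracket A X Y x)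
      = \<alpha> x (frechet_derivative (vf_rep A ?c Y) (at ?y) (X x))
        - \<alpha> x (frechet_derivative (vf_rep A ?c X) (at ?y) (Y x))"
    by (simp add: lie_bracket_def Let_def linear_diff)
  then show ?thesis
    using key[OF X, of "Y x"] key[OF Y, of "X x"] by (simp add: ext_deriv_def Let_def)
qed

text \<open>Differentiating the transformation rule of \<open>\<alpha>\<close> produces, besides the transformed derivative, a
  term in which \<open>\<alpha>\<close> is evaluated on a second derivative of the transition map. That term is symmetric,
  so antisymmetrising removes it, and \<open>d\<alpha>\<close> is given by the same formula in every chart.\<close>

lemma ext_deriv_in_chart:
  assumes U: "openin M U" "x \<in> U" and \<alpha>: "smooth_one_form A U \<alpha>" and c: "c \<in> A" "x \<in> cdom c"
  shows "ext_deriv A \<alpha> x (chart_deriv_inv A c x u) (chart_deriv_inv A c x v)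
     = frechet_derivative (\<lambda>z. form_rep A c \<alpha> z v) (at (coord c x)) u
     - frechet_derivative (\<lambda>z. form_rep A c \<alpha> z u) (at (coord c x)) v"
proof -
  let ?c = "chart_at A x"
  let ?B = "form_rep A ?c \<alpha>"
  let ?T = "transition c ?c"
  let ?z = "coord c x"
  let ?dT = "\<lambda>w z. frechet_derivative ?T (at z) w"
  have x: "x \<in> topspace M" using U openin_subset by blast
  note c0 = chart_at[OF x]
  let ?S = "coord c ` ((U \<inter> cdom ?c) \<inter> cdom c)"
  have "openin M (U \<inter> cdom ?c)"
    using U(1) atlas_is_chart[OF c0(1)] unfolding is_chart_def by blast
  then have S: "open ?S" "?z \<in> ?S"
    using open_coord_image[OF c(1)] U(2) c(2) c0(2) by auto
  have smooth: "smooth_on ?T ?S"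
    by (rule smooth_on_subset[OF transition_domain(2)[OF c(1) c0(1)]]) blast
  have Tz: "?T ?z = coord ?c x" by (rule transition_coord[OF c])
  have y: "coord ?c x \<in> coord ?c ` (U \<inter> cdom ?c)" using U(2) c0(2) by blast
  have dB: "(\<lambda>y. ?B y w) differentiable (at (?T ?z))" for w
    unfolding Tz by (rule form_rep_differentiable[OF c0(1) \<alpha> y])
  have dT: "?T differentiable (at ?z)" by (rule smooth_on_differentiable[OF smooth S(2)])
  have comp: "(\<lambda>z. ?B (?T z) w) differentiable (at ?z)"
    "frechet_derivative (\<lambda>z. ?B (?T z) w) (at ?z) u
       = frechet_derivative (\<lambda>y. ?B y w) (at (coord ?c x)) (?dT u ?z)" for u w
    using differentiable_chain_at[OF dT dB] frechet_derivative_compose[OF dT dB] Tz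
    by (auto simp: comp_def)
  have key: "frechet_derivative (\<lambda>z. form_rep A c \<alpha> z w) (at ?z) u
      = frechet_derivative (\<lambda>y. ?B y (?dT w ?z)) (at (coord ?c x)) (?dT u ?z)
      + \<alpha> x (frechet_derivative (?dT w) (at ?z) u)" for u w
  proof -
    have "((\<lambda>z. ?B (?T z) (?dT w z)) has_derivative
        (\<lambda>u. frechet_derivative (\<lambda>z. ?B (?T z) (?dT w ?z)) (at ?z) u
           + ?B (?T ?z) (frechet_derivative (?dT w) (at ?z) u))) (at ?z)"
    proof (rule has_derivative_pairing[OF S])
      fix z assume "z \<in> ?S"
      then obtain p where p: "z = coord c p" "p \<in> U" "p \<in> cdom ?c" "p \<in> cdom c" by blast
      then have "?T z \<in> coord ?c ` (U \<inter> cdom ?c)" by (simp add: transition_coord[OF c(1)])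
      then show "linear (?B (?T z))" by (rule linear_form_rep[OF c0(1) \<alpha>])
    qed (use comp(1) smooth_on_differentiable[OF smooth_on_frechet_derivative[OF smooth] S(2)] in auto)
    then have "((\<lambda>z. form_rep A c \<alpha> z w) has_derivative
        (\<lambda>u. frechet_derivative (\<lambda>z. ?B (?T z) (?dT w ?z)) (at ?z) u
           + ?B (?T ?z) (frechet_derivative (?dT w) (at ?z) u))) (at ?z)"
    proof (rule has_derivative_transform_within_open[OF _ S])
      fix z assume "z \<in> ?S"
      then obtain p where p: "z = coord c p" "p \<in> cdom ?c" "p \<in> cdom c" by blast
      show "?B (?T z) (?dT w z) = form_rep A c \<alpha> z w"
        unfolding p(1) transition_coord[OF c(1) p(3)] using form_rep_transition[OF c(1) p(3) c0(1) p(2)] by simp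
    qed
    moreover have "?B (?T ?z) = \<alpha> x"
      unfolding Tz using form_rep_coord[OF c0] chart_deriv_chart_at(2)[OF x] by auto
    ultimately have "((\<lambda>z. form_rep A c \<alpha> z w) has_derivative
        (\<lambda>u. frechet_derivative (\<lambda>y. ?B y (?dT w ?z)) (at (coord ?c x)) (?dT u ?z)
           + \<alpha> x (frechet_derivative (?dT w) (at ?z) u))) (at ?z)"
      by (simp only: comp(2))
    then show ?thesis by (rule fun_cong[OF frechet_derivative_at[symmetric]])
  qed
  show ?thesis
    using key[of v u] key[of u v] smooth_on_symmetric_second_derivative[OF smooth S, of u v]
    by (simp add: ext_deriv_def Let_def chart_deriv_inv_def)
qed

text \<open>In a chart that flattens the integral manifold through \<open>x\<close>, the coefficients of \<open>\<alpha>\<close> along the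
  flat directions \<open>W\<close> vanish on that manifold, hence so do their derivatives in the directions of
  \<open>W\<close>; only such derivatives enter \<open>d\<alpha>\<close> on \<open>W\<close>.\<close>

lemma ext_deriv_vanishes_on_integrable:
  assumes U: "openin M U" "x \<in> U" and \<alpha>: "smooth_one_form A U \<alpha>"
    and P: "integrable_distribution M A P" "\<And>y v. y \<in> U \<Longrightarrow> v \<in> P y \<Longrightarrow> \<alpha> y v = 0"
    and uv: "u \<in> P x" "v \<in> P x"
  shows "ext_deriv A \<alpha> x u v = 0"
proof -
  have x: "x \<in> topspace M" using U openin_subset by blast
  obtain N where N: "x \<in> N" "integral_manifold M A P N"
    using P(1) x unfolding integrable_distribution_def by blast
  obtain c W where c: "c \<in> A" "x \<in> cdom c" and W: "subspace W"
    and flat: "coord c ` (N \<inter> cdom c) = {z \<in> coord c ` cdom c. z - coord c x \<in> W}"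
    and tangent: "\<And>y. y \<in> N \<inter> cdom c \<Longrightarrow> P y = {v. chart_deriv A c y v \<in> W}"
    using N unfolding integral_manifold_def by meson
  let ?S = "coord c ` (U \<inter> cdom c)"
  have S: "open ?S" "coord c x \<in> ?S" using open_coord_image[OF c(1) U(1)] U(2) c(2) by auto
  have zero: "frechet_derivative (\<lambda>z. form_rep A c \<alpha> z w) (at (coord c x)) w' = 0"
    if w: "w \<in> W" "w' \<in> W" for w w'
  proof (rule frechet_derivative_zero_along_subspace[OF form_rep_differentiable[OF c(1) \<alpha> S(2)] S W w(2)])
    fix z assume z: "z \<in> ?S" "z - coord c x \<in> W"
    then obtain p where p: "p \<in> U" "p \<in> cdom c" "z = coord c p" by blast
    have "z \<in> coord c ` (N \<inter> cdom c)" using z flat by blast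
    then obtain q where q: "q \<in> N" "q \<in> cdom c" "z = coord c q" by blast
    have "p = q" using p q coord_inv_coord[OF c(1)] by metis
    then have "chart_deriv_inv A c p w \<in> P p"
      using q tangent chart_deriv_inverse(1)[OF c(1) p(2)] w(1) by auto
    then show "form_rep A c \<alpha> z w = 0"
      using P(2)[OF p(1)] form_rep_coord[OF c(1) p(2)] p(3) by simp
  qed
  have "chart_deriv A c x u \<in> W" "chart_deriv A c x v \<in> W"
    using uv tangent N(1) c(2) by auto
  then show ?thesis
    using ext_deriv_in_chart[OF U \<alpha> c, of "chart_deriv A c x u" "chart_deriv A c x v"]
    by (simp add: zero chart_deriv_inverse(2)[OF c])
qed

section \<open>The Levi tensor of a k-contact distribution\<close>

lemma smooth_vf_subset:
  assumes "smooth_vf A U X" "U' \<subseteq> U"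
  shows "smooth_vf A U' X"
proof -
  have "coord c ` (U' \<inter> cdom c) \<subseteq> coord c ` (U \<inter> cdom c)" for c :: "('m, 'e) chart"
    using assms(2) by blast
  then show ?thesis
    using assms(1) smooth_on_subset unfolding smooth_vf_def by metis
qed

lemma smooth_one_form_subset:
  assumes "smooth_one_form A U \<alpha>" "U' \<subseteq> U"
  shows "smooth_one_form A U' \<alpha>"
proof -
  have "coord c ` (U' \<inter> cdom c) \<subseteq> coord c ` (U \<inter> cdom c)" for c :: "('m, 'e) chart"
    using assms(2) by blast
  then show ?thesis
    using assms smooth_on_subset unfolding smooth_one_form_def by (metis subsetD)
qed

lemma smooth_vf_sum_scaleR:
  assumes "openin M U" "finite I" "\<And>i. i \<in> I \<Longrightarrow> smooth_vf A U (b i)"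
  shows "smooth_vf A U (\<lambda>y. \<Sum>i\<in>I. r i *\<^sub>R b i y)"
  unfolding smooth_vf_def
proof
  fix c assume c: "c \<in> A"
  have op: "open (coord c ` (U \<inter> cdom c))" by (rule open_coord_image[OF c assms(1)])
  have "smooth_on (\<lambda>y. \<Sum>i\<in>I. r i *\<^sub>R vf_rep A c (b i) y) (coord c ` (U \<inter> cdom c))"
    using assms(2,3) c op unfolding smooth_vf_def by (intro smooth_on_sum_scaleR) auto
  then show "smooth_on (vf_rep A c (\<lambda>y. \<Sum>i\<in>I. r i *\<^sub>R b i y)) (coord c ` (U \<inter> cdom c))"
  proof (rule smooth_on_cong[OF _ op])
    fix z assume "z \<in> coord c ` (U \<inter> cdom c)"
    then obtain p where p: "z = coord c p" "p \<in> cdom c" by blast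
    have pM: "p \<in> topspace M" using p(2) c cdom_topspace by blast
    have "linear (chart_deriv A c p)"
      unfolding chart_deriv_def using linear_transition_deriv chart_at[OF pM] c p(2) by blast
    then show "(\<Sum>i\<in>I. r i *\<^sub>R vf_rep A c (b i) z) = vf_rep A c (\<lambda>y. \<Sum>i\<in>I. r i *\<^sub>R b i y) z"
      unfolding vf_rep_def p(1) coord_inv_coord[OF c p(2)] by (simp add: linear_sum linear_cmul)
  qed
qed

text \<open>A tangent vector extends with constant coefficients in a local frame.\<close>

lemma local_section_exists:
  assumes "subbundle M A r D" "x \<in> topspace M" "u \<in> D x"
  obtains X where "local_section M A D x X" "X x = u"
proof -
  from bspec[OF assms(1)[unfolded subbundle_def] assms(2)]
  obtain U b where U: "openin M U" "x \<in> U"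
    and frame: "\<forall>i<r. smooth_vf A U (b i)"
      "\<forall>y\<in>U. D y = span ((\<lambda>i. b i y) ` {..<r}) \<and> dim (D y) = r"
    by (elim exE conjE)
  have b: "smooth_vf A U (b i)" if "i < r" for i using frame(1) that by blast
  have D: "D y = span ((\<lambda>i. b i y) ` {..<r})" if "y \<in> U" for y using frame(2) that by blast
  have "u \<in> span ((\<lambda>i. b i x) ` {..<r})" using assms(3) D U(2) by blast
  then have "\<exists>a. u = (\<Sum>i<r. a i *\<^sub>R b i x)"
  proof (induction rule: span_induct_alt)
    case base
    show ?case by (rule exI[of _ "\<lambda>_. 0"]) simp
  next
    case (step s w y)
    then obtain j a where j: "j < r" "w = b j x" and a: "y = (\<Sum>i<r. a i *\<^sub>R b i x)" by auto
    have "(\<Sum>i<r. (a i + (if i = j then s else 0)) *\<^sub>R b i x)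
        = y + (\<Sum>i<r. if i = j then s *\<^sub>R b i x else 0)"
      unfolding a sum.distrib[symmetric] by (rule sum.cong) (auto simp: scaleR_add_left)
    also have "\<dots> = s *\<^sub>R w + y" using j by simp
    finally have "s *\<^sub>R w + y = (\<Sum>i<r. (a i + (if i = j then s else 0)) *\<^sub>R b i x)" by (rule sym)
    then show ?case by (rule exI[of _ "\<lambda>i. a i + (if i = j then s else 0)"])
  qed
  then obtain a where a: "u = (\<Sum>i<r. a i *\<^sub>R b i x)" by blast
  define X where "X y = (\<Sum>i<r. a i *\<^sub>R b i y)" for y
  have "smooth_vf A U X"
    unfolding X_def using U(1) b by (intro smooth_vf_sum_scaleR) auto
  moreover have "X y \<in> D y" if "y \<in> U" for y
    unfolding X_def D[OF that] by (intro span_sum span_scale span_base) auto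
  ultimately have "local_section M A D x X" unfolding local_section_def using U by blast
  moreover have "X x = u" using a X_def by simp
  ultimately show ?thesis by (rule that)
qed

lemma lie_bracket_mem_iff:
  assumes U: "k_contact_form M A k U \<eta>" "x \<in> U" and D: "\<And>y. y \<in> U \<Longrightarrow> D y = ker_form k \<eta> y"
    and X: "local_section M A D x X" and Y: "local_section M A D x Y"
  shows "lie_bracket A X Y x \<in> D x \<longleftrightarrow> (\<forall>a<k. ext_deriv A (\<eta> a) x (X x) (Y x) = 0)"
proof -
  obtain V where V: "openin M V" "x \<in> V" "smooth_vf A V X" "\<And>y. y \<in> V \<Longrightarrow> X y \<in> D y"
    using X unfolding local_section_def by blast
  obtain W where W: "openin M W" "x \<in> W" "smooth_vf A W Y" "\<And>y. y \<in> W \<Longrightarrow> Y y \<in> D y"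
    using Y unfolding local_section_def by blast
  let ?O = "U \<inter> V \<inter> W"
  have O: "openin M ?O" "x \<in> ?O"
    using U V W unfolding k_contact_form_def by auto
  have "\<eta> a x (lie_bracket A X Y x) = - ext_deriv A (\<eta> a) x (X x) (Y x)" if a: "a < k" for a
  proof (rule form_lie_bracket[OF O])
    have "smooth_one_form A U (\<eta> a)" using U(1) a unfolding k_contact_form_def by blast
    then show "smooth_one_form A ?O (\<eta> a)" by (rule smooth_one_form_subset) blast
    show "smooth_vf A ?O X" by (rule smooth_vf_subset[OF V(3)]) blast
    show "smooth_vf A ?O Y" by (rule smooth_vf_subset[OF W(3)]) blast
    show "\<eta> a y (X y) = 0" "\<eta> a y (Y y) = 0" if "y \<in> ?O" for y
      using that V(4)[of y] W(4)[of y] D[of y] a by (auto simp: ker_form_def)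
  qed
  then show ?thesis using D[OF U(2)] by (auto simp: ker_form_def)
qed

text \<open>The Levi tensor collects the brackets of all extensions of \<open>u\<close> and \<open>v\<close>. Whether such a bracket
  lies in \<open>D x\<close> depends on \<open>u\<close> and \<open>v\<close> only, through \<open>d\<eta>\<close>; that there is an extension at all is
  needed both to test \<open>d\<eta>\<close> and to obtain the whole of \<open>D x\<close>.\<close>

lemma isotropic_iff:
  assumes sub: "subbundle M A r D"
    and U: "k_contact_form M A k U \<eta>" "x \<in> U" and D: "\<And>y. y \<in> U \<Longrightarrow> D y = ker_form k \<eta> y"
  shows "isotropic M A D x E \<longleftrightarrow> subspace E \<and> E \<subseteq> D x \<and>
     (\<forall>a<k. \<forall>u\<in>E. \<forall>v\<in>E. ext_deriv A (\<eta> a) x u v = 0)"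
proof -
  have x: "x \<in> topspace M" using U openin_subset unfolding k_contact_form_def by blast
  have Dx: "subspace (D x)"
    using D[OF U(2)] U unfolding k_contact_form_def direct_sum_def by auto
  have "levi M A D x u v = D x \<longleftrightarrow> (\<forall>a<k. ext_deriv A (\<eta> a) x u v = 0)" (is "?L = ?R")
    if uv: "u \<in> D x" "v \<in> D x" for u v
  proof
    assume ?L
    obtain X where X: "local_section M A D x X" "X x = u" using local_section_exists[OF sub x uv(1)] .
    obtain Y where Y: "local_section M A D x Y" "Y x = v" using local_section_exists[OF sub x uv(2)] .
    have "lie_bracket A X Y x + 0 \<in> levi M A D x u v"
      unfolding levi_def using X Y subspace_0[OF Dx] by blast
    then have "lie_bracket A X Y x \<in> D x" using \<open>?L\<close> by simp
    then show ?R using lie_bracket_mem_iff[OF U D X(1) Y(1)] X(2) Y(2) by simp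
  next
    assume ?R
    then have mem: "lie_bracket A X Y x \<in> D x"
      if "local_section M A D x X" "X x = u" "local_section M A D x Y" "Y x = v" for X Y
      using lie_bracket_mem_iff[OF U D that(1,3)] that(2,4) by simp
    show ?L
    proof
      show "levi M A D x u v \<subseteq> D x"
        unfolding levi_def using mem subspace_add[OF Dx] by blast
      show "D x \<subseteq> levi M A D x u v"
      proof
        fix d assume d: "d \<in> D x"
        obtain X where X: "local_section M A D x X" "X x = u" using local_section_exists[OF sub x uv(1)] .
        obtain Y where Y: "local_section M A D x Y" "Y x = v" using local_section_exists[OF sub x uv(2)] .
        have "d - lie_bracket A X Y x \<in> D x" using mem[OF X Y] d subspace_diff[OF Dx] by blast
        moreover have "d = lie_bracket A X Y x + (d - lie_bracket A X Y x)" by simp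
        ultimately show "d \<in> levi M A D x u v" unfolding levi_def using X Y by blast
      qed
    qed
  qed
  then show ?thesis unfolding isotropic_def by blast
qed

text \<open>The forms are nondegenerate because a vector that is \<open>d\<eta>\<close>-orthogonal to the kernel of \<open>\<eta>\<close> is
  \<open>d\<eta>\<close>-orthogonal to all tangent vectors, the complement of that kernel being the kernel of \<open>d\<eta>\<close>.\<close>

lemma k_contact_alternating_forms:
  assumes "k_contact_form M A k U \<eta>" "x \<in> U"
  shows "alternating_forms (ker_form k \<eta> x) k (\<lambda>a. ext_deriv A (\<eta> a) x)"
proof (rule alternating_forms.intro)
  have U: "openin M U" and \<eta>: "\<And>a. a < k \<Longrightarrow> smooth_one_form A U (\<eta> a)"
    and ds: "direct_sum UNIV (ker_form k \<eta> x) (ker_ext_deriv A k \<eta> x)"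
    using assms unfolding k_contact_form_def by auto
  show "subspace (ker_form k \<eta> x)" using ds unfolding direct_sum_def by blast
  show lin: "linear (ext_deriv A (\<eta> a) x u)" if "a < k" for a u
    by (rule linear_ext_deriv[OF U \<eta>[OF that] assms(2)])
  show "ext_deriv A (\<eta> a) x u v = - ext_deriv A (\<eta> a) x v u" if "a < k" for a u v
    by (rule ext_deriv_alternating)
  fix v assume v: "v \<in> ker_form k \<eta> x"
    and orth: "\<And>a w. a < k \<Longrightarrow> w \<in> ker_form k \<eta> x \<Longrightarrow> ext_deriv A (\<eta> a) x v w = 0"
  have "ext_deriv A (\<eta> a) x v w = 0" if a: "a < k" for a w
  proof -
    obtain p q where pq: "p \<in> ker_form k \<eta> x" "q \<in> ker_ext_deriv A k \<eta> x" "w = p + q"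
      using ds UNIV_I[of w] unfolding direct_sum_def by blast
    have "ext_deriv A (\<eta> a) x v q = - ext_deriv A (\<eta> a) x q v" by (rule ext_deriv_alternating)
    also have "\<dots> = 0" using pq(2) a by (simp add: ker_ext_deriv_def)
    finally show ?thesis using orth[OF a pq(1)] lin[OF a] pq(3) by (simp add: linear_add)
  qed
  then have "v \<in> ker_ext_deriv A k \<eta> x" by (simp add: ker_ext_deriv_def)
  then show "v = 0" using v ds unfolding direct_sum_def by blast
qed

end

section \<open>First-order polarised k-contact manifolds\<close>

theorem proposition6p4:
  fixes M :: "'m topology"
    and A :: "('m, 'e::euclidean_space) chart set"
    and n k :: nat
    and D P :: "'m \<Rightarrow> 'e set"
  assumes "first_order_polarised M A n k D P"
  shows "polarisation M A D P"
proof -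
  have kc: "k_contact_manifold M A k D" and dims: "DIM('e) = n * k + n + k"
    and P: "subbundle M A (n * k) P" "\<And>x. x \<in> topspace M \<Longrightarrow> P x \<subseteq> D x"
      "integrable_distribution M A P"
    using assms unfolding first_order_polarised_def by auto
  interpret manifold_with_atlas M A
    using kc unfolding k_contact_manifold_def by unfold_locales blast
  obtain r where D: "subbundle M A r D" using kc unfolding k_contact_manifold_def by blast
  have pointwise: "legendrian M A D x (P x) \<and> (\<forall>E. isotropic M A D x E \<longrightarrow> dim E \<le> dim (P x))"
    if x: "x \<in> topspace M" for x
  proof -
    obtain U \<eta> where U: "k_contact_form M A k U \<eta>" "x \<in> U"
      and ker: "\<And>y. y \<in> U \<Longrightarrow> D y = ker_form k \<eta> y"
      using kc x unfolding k_contact_manifold_def by meson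
    have opU: "openin M U" and \<eta>: "\<And>a. a < k \<Longrightarrow> smooth_one_form A U (\<eta> a)"
      using U(1) unfolding k_contact_form_def by auto
    interpret F: alternating_forms "D x" k "\<lambda>a. ext_deriv A (\<eta> a) x"
      using k_contact_alternating_forms[OF U] ker[OF U(2)] by simp
    have iso: "isotropic M A D x E \<longleftrightarrow> F.totally_isotropic E" for E
      using isotropic_iff[OF D U ker] unfolding F.totally_isotropic_def by blast
    have dimP: "dim (P x) = n * k" and subP: "subspace (P x)"
      using P(1) x unfolding subbundle_def by (metis, metis subspace_span)
    have dimD: "dim (D x) = n * k + n"
      using U dims ker[OF U(2)] unfolding k_contact_form_def by auto
    have "ext_deriv A (\<eta> a) x u v = 0" if "a < k" "u \<in> P x" "v \<in> P x" for a u v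
    proof (rule ext_deriv_vanishes_on_integrable[OF opU U(2) \<eta>[OF that(1)] P(3) _ that(2,3)])
      fix y w assume "y \<in> U" "w \<in> P y"
      then have "w \<in> ker_form k \<eta> y" using P(2) ker opU openin_subset by blast
      then show "\<eta> a y w = 0" using that(1) by (simp add: ker_form_def)
    qed
    then have van: "F.totally_isotropic (P x)"
      unfolding F.totally_isotropic_def using subP P(2)[OF x] by blast
    obtain G where G: "direct_sum (D x) (P x) G" "dim (P x) + dim G = dim (D x)"
      using orthogonal_direct_sum[OF F.V subP P(2)[OF x]] .
    have "dim (P x) = k * dim G" using G(2) dimP dimD by simp
    then obtain G' where "F.totally_isotropic G'" "direct_sum (D x) (P x) G'"
      using F.totally_isotropic_complement[OF van G(1)] by blast
    then have "legendrian M A D x (P x)" unfolding legendrian_def iso using van by blast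
    moreover have "dim E \<le> dim (P x)" if "isotropic M A D x E" for E
    proof -
      have E: "F.totally_isotropic E" using that iso by blast
      then obtain H where H: "direct_sum (D x) E H" "dim E + dim H = dim (D x)"
        using orthogonal_direct_sum[OF F.V, of E] unfolding F.totally_isotropic_def by blast
      have le: "dim E \<le> k * dim H" by (rule F.totally_isotropic_dim_le[OF E H(1)])
      \<comment> \<open>\<open>dim E + dim H = n (k + 1)\<close>, so more than \<open>n k\<close> for \<open>E\<close> would leave less than \<open>n\<close> for \<open>H\<close>.\<close>
      show ?thesis
      proof (rule ccontr)
        assume "\<not> dim E \<le> dim (P x)"
        then have "n * k < dim E" "dim H \<le> n" using dimP dimD H(2) by auto
        then have "k * dim H \<le> n * k" by (simp add: mult.commute)
        with le \<open>n * k < dim E\<close> show False by simp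
      qed
    qed
    ultimately show ?thesis by blast
  qed
  show ?thesis
    unfolding polarisation_def integrable_legendrian_subbundle_def
    using P pointwise unfolding legendrian_def by blast
qed

end
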